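(* Let $D$ be a finite-dimensional division algebra over a field $k$. Then there is an isomorphism of coalgebras $D[[x]]^\circ\simeq D^*\otimes\mathcal{DC}$.
   Context: $D[[x]]$ is the power series ring over $D$ in one variable $x$ commuting with the elements of $D$. For a $k$-algebra $A$, the finite dual $A^\circ$ is the coalgebra of all $f\in\mathrm{Hom}_k(A,k)$ whose kernel contains a two-sided ideal of finite codimension. $D^*=\mathrm{Hom}_k(D,k)$ is the dual coalgebra of $D$. The divided power coalgebra $\mathcal{DC}$ has $k$-basis $\{c_n: n\in\mathbb{N}\}$ ($0\in\mathbb{N}$) with $\Delta(c_n)=\sum_{i=0}^n c_i\otimes c_{n-i}$ and $\varepsilon(c_n)=\delta_{0,n}$. The tensor product over $k$ carries the usual tensor product coalgebra structure. *)

theory Defs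
  imports
    "HOL-Algebra.Module"
    "HOL-Algebra.Ideal"
    "HOL-Library.Poly_Mapping"
    "HOL-Computational_Algebra.Formal_Power_Series"
begin

section \<open>Algebras over a field\<close>

text \<open>
  The field and the algebras are types; coalgebras are records with a carrier over the
  field, because a tensor product depends on the scalar multiplications of its factors.
\<close>

definition type_ring :: "'a::ring_1 ring" where
  "type_ring = \<lparr>carrier = UNIV, monoid.mult = (*), one = 1, zero = 0, add = (+)\<rparr>"

locale k_algebra = vector_space scale
  for scale :: "'k::field \<Rightarrow> 'a::ring_1 \<Rightarrow> 'a" +
  assumes scale_mult_left: "scale c a * b = scale c (a * b)"
    and scale_mult_right: "a * scale c b = scale c (a * b)"

definition fps_scale :: "('k \<Rightarrow> 'a \<Rightarrow> 'a) \<Rightarrow> 'k \<Rightarrow> 'a fps \<Rightarrow> 'a fps" where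
  "fps_scale scale c f = Abs_fps (\<lambda>n. scale c (fps_nth f n))"

section \<open>Tensor products of vector spaces\<close>

text \<open>
  In the records below that stand for vector spaces, the inherited ring fields
  \<open>mult\<close> and \<open>one\<close> carry no meaning.
\<close>

definition scalar_space :: "('k::field, 'k) module" where
  "scalar_space = ring.extend type_ring (module.fields (*))"

definition linear_maps ::
    "('k, 'v, 'm) module_scheme \<Rightarrow> ('k, 'w, 'n) module_scheme \<Rightarrow> ('v \<Rightarrow> 'w) set" where
  "linear_maps V W = {f \<in> carrier V \<rightarrow> carrier W.
     (\<forall>x\<in>carrier V. \<forall>y\<in>carrier V. f (x \<oplus>\<^bsub>V\<^esub> y) = f x \<oplus>\<^bsub>W\<^esub> f y) \<and>
     (\<forall>c. \<forall>x\<in>carrier V. f (c \<odot>\<^bsub>V\<^esub> x) = c \<odot>\<^bsub>W\<^esub> f x)}"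

definition pm_scale :: "'k::field \<Rightarrow> ('a \<Rightarrow>\<^sub>0 'k) \<Rightarrow> ('a \<Rightarrow>\<^sub>0 'k)" where
  "pm_scale c = Poly_Mapping.map ((*) c)"

text \<open>
  The tensor product is the free vector space on pairs modulo bilinearity:
  \<open>Poly_Mapping.single (v, w) c\<close> is \<open>c\<close> times the generator \<open>(v, w)\<close>, and the elements of
  the tensor product are cosets of \<open>tensor_null V W\<close>.
\<close>

definition tensor_relators ::
    "('k::field, 'v, 'm) module_scheme \<Rightarrow> ('k, 'w, 'n) module_scheme \<Rightarrow> ('v \<times> 'w \<Rightarrow>\<^sub>0 'k) set" where
  "tensor_relators V W =
     {Poly_Mapping.single (v \<oplus>\<^bsub>V\<^esub> v', w) 1 - Poly_Mapping.single (v, w) 1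
        - Poly_Mapping.single (v', w) 1 | v v' w.
        v \<in> carrier V \<and> v' \<in> carrier V \<and> w \<in> carrier W} \<union>
     {Poly_Mapping.single (v, w \<oplus>\<^bsub>W\<^esub> w') 1 - Poly_Mapping.single (v, w) 1
        - Poly_Mapping.single (v, w') 1 | v w w'.
        v \<in> carrier V \<and> w \<in> carrier W \<and> w' \<in> carrier W} \<union>
     {Poly_Mapping.single (c \<odot>\<^bsub>V\<^esub> v, w) 1 - Poly_Mapping.single (v, w) c | c v w.
        v \<in> carrier V \<and> w \<in> carrier W} \<union>
     {Poly_Mapping.single (v, c \<odot>\<^bsub>W\<^esub> w) 1 - Poly_Mapping.single (v, w) c | c v w.
        v \<in> carrier V \<and> w \<in> carrier W}"

definition tensor_null ::
    "('k::field, 'v, 'm) module_scheme \<Rightarrow> ('k, 'w, 'n) module_scheme \<Rightarrow> ('v \<times> 'w \<Rightarrow>\<^sub>0 'k) set" where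
  "tensor_null V W = Modules.module.span pm_scale (tensor_relators V W)"

definition tensor_class ::
    "('k::field, 'v, 'm) module_scheme \<Rightarrow> ('k, 'w, 'n) module_scheme \<Rightarrow>
     ('v \<times> 'w \<Rightarrow>\<^sub>0 'k) \<Rightarrow> ('v \<times> 'w \<Rightarrow>\<^sub>0 'k) set" where
  "tensor_class V W u = {u + n | n. n \<in> tensor_null V W}"

definition tensor_space ::
    "('k::field, 'v, 'm) module_scheme \<Rightarrow> ('k, 'w, 'n) module_scheme \<Rightarrow>
     ('k, ('v \<times> 'w \<Rightarrow>\<^sub>0 'k) set) module" where
  "tensor_space V W =
     \<lparr>carrier = tensor_class V W ` {u. Poly_Mapping.keys u \<subseteq> carrier V \<times> carrier W},
      monoid.mult = undefined, one = undefined,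
      zero = tensor_null V W,
      add = (\<lambda>X Y. {x + y | x y. x \<in> X \<and> y \<in> Y}),
      smult = (\<lambda>c X. {pm_scale c x + n | x n. x \<in> X \<and> n \<in> tensor_null V W})\<rparr>"

definition pure_tensor ::
    "('k::field, 'v, 'm) module_scheme \<Rightarrow> ('k, 'w, 'n) module_scheme \<Rightarrow>
     'v \<Rightarrow> 'w \<Rightarrow> ('v \<times> 'w \<Rightarrow>\<^sub>0 'k) set" where
  "pure_tensor V W v w = tensor_class V W (Poly_Mapping.single (v, w) 1)"

text \<open>
  The linear map out of a tensor product induced by a bilinear map \<open>\<beta>\<close> into \<open>U\<close>.
  For bilinear \<open>\<beta>\<close> the value does not depend on the representative chosen.
\<close>

definition tensor_lift ::
    "('k::field, 'u, 'm) module_scheme \<Rightarrow> ('v \<Rightarrow> 'w \<Rightarrow> 'u) \<Rightarrow> ('v \<times> 'w \<Rightarrow>\<^sub>0 'k) set \<Rightarrow> 'u" where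
  "tensor_lift U \<beta> X =
     (let u = SOME u. u \<in> X
      in \<Oplus>\<^bsub>U\<^esub>p\<in>Poly_Mapping.keys u. Poly_Mapping.lookup u p \<odot>\<^bsub>U\<^esub> \<beta> (fst p) (snd p))"

definition tensor_map ::
    "('k::field, 'v1, 'm) module_scheme \<Rightarrow> ('k, 'w1, 'n) module_scheme \<Rightarrow>
     ('v \<Rightarrow> 'v1) \<Rightarrow> ('w \<Rightarrow> 'w1) \<Rightarrow> ('v \<times> 'w \<Rightarrow>\<^sub>0 'k) set \<Rightarrow> ('v1 \<times> 'w1 \<Rightarrow>\<^sub>0 'k) set" where
  "tensor_map V' W' f g =
     tensor_lift (tensor_space V' W') (\<lambda>v w. pure_tensor V' W' (f v) (g w))"

text \<open>\<open>(u \<otimes> v) \<otimes> w \<mapsto> u \<otimes> (v \<otimes> w)\<close>\<close>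

definition tensor_assoc ::
    "('k::field, 'u, 'l) module_scheme \<Rightarrow> ('k, 'v, 'm) module_scheme \<Rightarrow>
     ('k, 'w, 'n) module_scheme \<Rightarrow>
     (('u \<times> 'v \<Rightarrow>\<^sub>0 'k) set \<times> 'w \<Rightarrow>\<^sub>0 'k) set \<Rightarrow> ('u \<times> ('v \<times> 'w \<Rightarrow>\<^sub>0 'k) set \<Rightarrow>\<^sub>0 'k) set" where
  "tensor_assoc U V W =
     (let T = tensor_space U (tensor_space V W) in
      tensor_lift T (\<lambda>X w.
        tensor_lift T (\<lambda>u v.
          pure_tensor U (tensor_space V W) u (pure_tensor V W v w)) X))"

text \<open>\<open>(v \<otimes> v') \<otimes> (w \<otimes> w') \<mapsto> (v \<otimes> w) \<otimes> (v' \<otimes> w')\<close>, with \<open>v, v'\<close> in \<open>V\<close> and \<open>w, w'\<close> in \<open>W\<close>\<close>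

definition tensor_middle_swap ::
    "('k::field, 'v, 'm) module_scheme \<Rightarrow> ('k, 'w, 'n) module_scheme \<Rightarrow>
     (('v \<times> 'v \<Rightarrow>\<^sub>0 'k) set \<times> ('w \<times> 'w \<Rightarrow>\<^sub>0 'k) set \<Rightarrow>\<^sub>0 'k) set \<Rightarrow>
     (('v \<times> 'w \<Rightarrow>\<^sub>0 'k) set \<times> ('v \<times> 'w \<Rightarrow>\<^sub>0 'k) set \<Rightarrow>\<^sub>0 'k) set" where
  "tensor_middle_swap V W =
     (let P = tensor_space V W; T = tensor_space P P in
      tensor_lift T (\<lambda>X Y.
        tensor_lift T (\<lambda>v v'.
          tensor_lift T (\<lambda>w w'.
            pure_tensor P P (pure_tensor V W v w) (pure_tensor V W v' w')) Y) X))"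

section \<open>Coalgebras\<close>

record (overloaded) ('k::zero, 'c) coalg = "('k, 'c) module" +
  comult :: "'c \<Rightarrow> ('c \<times> 'c \<Rightarrow>\<^sub>0 'k) set"
  counit :: "'c \<Rightarrow> 'k"

locale coalgebra = Module.module type_ring C
  for C :: "('k::field, 'c, 'm) coalg_scheme" (structure) +
  assumes comult_linear: "comult C \<in> linear_maps C (tensor_space C C)"
    and counit_linear: "counit C \<in> linear_maps C scalar_space"
    and coassoc: "x \<in> carrier C \<Longrightarrow>
      tensor_assoc C C C (tensor_map (tensor_space C C) C (comult C) id (comult C x)) =
      tensor_map C (tensor_space C C) id (comult C) (comult C x)"
    and counit_left: "x \<in> carrier C \<Longrightarrow>
      tensor_lift C (\<lambda>a b. counit C a \<odot> b) (comult C x) = x"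
    and counit_right: "x \<in> carrier C \<Longrightarrow>
      tensor_lift C (\<lambda>a b. counit C b \<odot> a) (comult C x) = x"

definition coalgebra_hom ::
    "('k::field, 'c, 'm) coalg_scheme \<Rightarrow> ('k, 'd, 'n) coalg_scheme \<Rightarrow> ('c \<Rightarrow> 'd) set" where
  "coalgebra_hom C D = {\<phi> \<in> linear_maps C D. \<forall>x\<in>carrier C.
     tensor_map D D \<phi> \<phi> (comult C x) = comult D (\<phi> x) \<and> counit D (\<phi> x) = counit C x}"

definition coalgebra_isomorphic ::
    "('k::field, 'c, 'm) coalg_scheme \<Rightarrow> ('k, 'd, 'n) coalg_scheme \<Rightarrow> bool" where
  "coalgebra_isomorphic C D \<longleftrightarrow> coalgebra C \<and> coalgebra D \<and>
     (\<exists>\<phi>\<in>coalgebra_hom C D. bij_betw \<phi> (carrier C) (carrier D))"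

definition tensor_coalgebra ::
    "('k::field, 'c, 'm) coalg_scheme \<Rightarrow> ('k, 'd, 'n) coalg_scheme \<Rightarrow>
     ('k, ('c \<times> 'd \<Rightarrow>\<^sub>0 'k) set) coalg" where
  "tensor_coalgebra C D = module.extend (tensor_space C D) (coalg.fields
     (\<lambda>t. tensor_middle_swap C D
        (tensor_map (tensor_space C C) (tensor_space D D) (comult C) (comult D) t))
     (tensor_lift scalar_space (\<lambda>c d. counit C c * counit D d)))"

section \<open>Dual coalgebras of algebras\<close>

definition functional_space :: "('a \<Rightarrow> 'k::field) set \<Rightarrow> ('k, 'a \<Rightarrow> 'k) module" where
  "functional_space F =
     \<lparr>carrier = F, monoid.mult = undefined, one = undefined,
      zero = (\<lambda>_. 0), add = (\<lambda>f g a. f a + g a), smult = (\<lambda>c f a. c * f a)\<rparr>"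

text \<open>
  The comultiplication is the transpose of the algebra multiplication: \<open>\<Delta> f = \<Sum> g\<^sub>i \<otimes> h\<^sub>i\<close>
  is the element of \<open>F \<otimes> F\<close> with \<open>f (a * b) = \<Sum> g\<^sub>i a * h\<^sub>i b\<close>. It is unique if it exists, and
  it exists for both spaces \<open>F\<close> used below (in the case of the full dual, because the
  algebra is finite-dimensional).
\<close>

definition functional_coalgebra ::
    "('a::ring_1 \<Rightarrow> 'k::field) set \<Rightarrow> ('k, 'a \<Rightarrow> 'k) coalg" where
  "functional_coalgebra F = (let V = functional_space F in
     module.extend V (coalg.fields
       (\<lambda>f. THE t. t \<in> carrier (tensor_space V V) \<and>
          (\<forall>a b. tensor_lift scalar_space (\<lambda>g h. g a * h b) t = f (a * b)))
       (\<lambda>f. f 1)))"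

definition dual_space :: "('k::field \<Rightarrow> 'a::ring_1 \<Rightarrow> 'a) \<Rightarrow> ('a \<Rightarrow> 'k) set" where
  "dual_space scale = {f. Vector_Spaces.linear scale (*) f}"

definition finite_codimension :: "('k::field \<Rightarrow> 'a::ring_1 \<Rightarrow> 'a) \<Rightarrow> 'a set \<Rightarrow> bool" where
  "finite_codimension scale I \<longleftrightarrow>
     (\<exists>B. finite B \<and> Modules.module.span scale (I \<union> B) = UNIV)"

text \<open>For an infinite-dimensional algebra, \<open>dual_coalgebra\<close> is in general not a coalgebra.\<close>

definition dual_coalgebra ::
    "('k::field \<Rightarrow> 'a::ring_1 \<Rightarrow> 'a) \<Rightarrow> ('k, 'a \<Rightarrow> 'k) coalg" where
  "dual_coalgebra scale = functional_coalgebra (dual_space scale)"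

definition finite_dual_coalgebra ::
    "('k::field \<Rightarrow> 'a::ring_1 \<Rightarrow> 'a) \<Rightarrow> ('k, 'a \<Rightarrow> 'k) coalg" where
  "finite_dual_coalgebra scale = functional_coalgebra
     {f \<in> dual_space scale.
        \<exists>I. ideal I type_ring \<and> finite_codimension scale I \<and> (\<forall>a\<in>I. f a = 0)}"

section \<open>The divided power coalgebra\<close>

text \<open>The basis element \<open>c\<^sub>n\<close> is \<open>Poly_Mapping.single n 1\<close>.\<close>

definition divided_power_space :: "('k::field, nat \<Rightarrow>\<^sub>0 'k) module" where
  "divided_power_space =
     \<lparr>carrier = UNIV, monoid.mult = undefined, one = undefined,
      zero = 0, add = (+), smult = pm_scale\<rparr>"

definition divided_power_coalgebra :: "('k::field, nat \<Rightarrow>\<^sub>0 'k) coalg" where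
  "divided_power_coalgebra =
     (let V = divided_power_space; T = tensor_space V V in
      module.extend V (coalg.fields
        (\<lambda>u. \<Oplus>\<^bsub>T\<^esub>n\<in>Poly_Mapping.keys u. Poly_Mapping.lookup u n \<odot>\<^bsub>T\<^esub>
          (\<Oplus>\<^bsub>T\<^esub>i\<in>{..n}. pure_tensor V V (Poly_Mapping.single i 1) (Poly_Mapping.single (n - i) 1)))
        (\<lambda>u. \<Sum>n\<in>Poly_Mapping.keys u. Poly_Mapping.lookup u n * (if n = 0 then 1 else 0))))"

end

theory Submission
  imports Defs
begin

text \<open>
  Call a coalgebra \<open>C\<close> coordinatized by a monoid \<open>M\<close> if there are functionals \<open>e\<^sub>a\<close> (\<open>a \<in> M\<close>) on
  \<open>C\<close> that separate its points, transpose the product of \<open>M\<close>, that is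
  \<open>(e\<^sub>a \<otimes> e\<^sub>b) (\<Delta> x) = e\<^sub>a\<^sub>b x\<close>, and satisfy \<open>\<epsilon> = e\<^sub>1\<close>. Separating families are stable under tensor
  products (\<open>separating_tensor\<close>), so any equation between elements of tensor powers of \<open>C\<close> can be
  tested on coordinates, where coassociativity and the counit laws turn into the monoid laws of
  \<open>M\<close> (\<open>monoid_coordinates.coalgebra\<close>). For the same reason a map that pulls the coordinates of
  its target back along a monoid homomorphism is a coalgebra homomorphism
  (\<open>coalgebra_hom_coordinates\<close>).

  All coalgebras involved have such coordinates: \<open>D\<^sup>*\<close> and the finite dual of \<open>D[[x]]\<close> through
  evaluation at elements of the algebra, the divided power coalgebra through its coefficients,
  indexed by the additive monoid of natural numbers, and a tensor product through the product
  monoid. It remains to compare coordinates along the monoid homomorphism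
  \<open>(d, i) \<mapsto> d x\<^sup>i\<close>.

  The ring theory enters in one place. Over a division ring, a nonzero power series generates the
  ideal of a power of \<open>x\<close>, and the zero ideal has infinite codimension. Hence the finite dual
  consists of the functionals that vanish on all series of some order \<open>N\<close>
  (\<open>finite_dual_eq\<close>). Such a functional is determined by its values at the \<open>d x\<^sup>i\<close>, and those
  values may form an arbitrary finitely supported sequence in \<open>D\<^sup>*\<close>, which is an element of
  \<open>D\<^sup>* \<otimes> DC\<close>.
\<close>

section \<open>Vector spaces with a carrier\<close>

abbreviation vspace :: "('k::field, 'v, 'm) module_scheme \<Rightarrow> bool" where
  "vspace V \<equiv> Module.module (type_ring :: 'k ring) V"

lemma type_ring_simps [simp]:
  "carrier type_ring = UNIV" "add type_ring = (+)" "zero type_ring = 0"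
  "monoid.mult type_ring = (*)" "one type_ring = 1"
  by (simp_all add: type_ring_def)

lemma abelian_group_type_ring: "abelian_group (type_ring :: 'a::ring_1 ring)"
proof (rule abelian_groupI)
  show "\<exists>y\<in>carrier type_ring. y \<oplus>\<^bsub>type_ring\<^esub> x = \<zero>\<^bsub>type_ring\<^esub>" for x :: 'a
    by (intro bexI[of _ "- x"]) simp_all
qed (simp_all add: add_ac)

lemma ring_type_ring: "ring (type_ring :: 'a::ring_1 ring)"
  by (rule ringI[OF abelian_group_type_ring monoidI]) (simp_all add: algebra_simps)

lemma cring_type_ring: "cring (type_ring :: 'k::field ring)"
  by (rule cringI[OF abelian_group_type_ring comm_monoidI]) (simp_all add: algebra_simps)

lemma scalar_space_simps [simp]:
  "carrier scalar_space = UNIV" "add scalar_space = (+)" "zero scalar_space = 0"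
  "smult scalar_space = (*)"
  by (simp_all add: scalar_space_def type_ring_def ring.defs module.defs)

lemma vspaceI:
  fixes V :: "('k::field, 'v, 'm) module_scheme" (structure)
  assumes "\<zero> \<in> carrier V"
    and "\<And>x y. x \<in> carrier V \<Longrightarrow> y \<in> carrier V \<Longrightarrow> x \<oplus> y \<in> carrier V"
    and "\<And>c x. x \<in> carrier V \<Longrightarrow> c \<odot> x \<in> carrier V"
    and "\<And>x y z. x \<in> carrier V \<Longrightarrow> y \<in> carrier V \<Longrightarrow> z \<in> carrier V \<Longrightarrow>
      (x \<oplus> y) \<oplus> z = x \<oplus> (y \<oplus> z)"
    and "\<And>x y. x \<in> carrier V \<Longrightarrow> y \<in> carrier V \<Longrightarrow> x \<oplus> y = y \<oplus> x"
    and "\<And>x. x \<in> carrier V \<Longrightarrow> \<zero> \<oplus> x = x"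
    and "\<And>x. x \<in> carrier V \<Longrightarrow> (-1) \<odot> x \<oplus> x = \<zero>"
    and "\<And>a b x. x \<in> carrier V \<Longrightarrow> (a + b) \<odot> x = a \<odot> x \<oplus> b \<odot> x"
    and "\<And>a x y. x \<in> carrier V \<Longrightarrow> y \<in> carrier V \<Longrightarrow> a \<odot> (x \<oplus> y) = a \<odot> x \<oplus> a \<odot> y"
    and "\<And>a b x. x \<in> carrier V \<Longrightarrow> (a * b) \<odot> x = a \<odot> (b \<odot> x)"
    and "\<And>x. x \<in> carrier V \<Longrightarrow> 1 \<odot> x = x"
  shows "vspace V"
proof (rule moduleI)
  show "abelian_group V"
  proof (rule abelian_groupI)
    show "\<exists>y\<in>carrier V. y \<oplus> x = \<zero>" if "x \<in> carrier V" for x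
      using assms(3)[OF that] assms(7)[OF that] by blast
  qed (fact assms(1,2,4,5,6))+
  show "cring (type_ring :: 'k ring)" by (rule cring_type_ring)
qed (simp_all add: assms)

lemma scalar_vspace: "vspace (scalar_space :: ('k::field, 'k) module)"
  by (rule vspaceI) (auto simp: algebra_simps)

lemma finsum_scalar_space:
  "finite A \<Longrightarrow> finsum (scalar_space :: ('k::field, 'k) module) f A = sum f A"
proof (induction A rule: finite_induct)
  case empty
  interpret S: Module.module type_ring "scalar_space :: ('k, 'k) module" by (rule scalar_vspace)
  show ?case by simp
next
  case (insert a A)
  interpret S: Module.module type_ring "scalar_space :: ('k, 'k) module" by (rule scalar_vspace)
  show ?case using insert by (subst S.finsum_insert) auto
qed

section \<open>Linear maps\<close>

lemma linear_mapsI: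
  assumes "\<And>x. x \<in> carrier V \<Longrightarrow> f x \<in> carrier W"
    and "\<And>x y. x \<in> carrier V \<Longrightarrow> y \<in> carrier V \<Longrightarrow> f (x \<oplus>\<^bsub>V\<^esub> y) = f x \<oplus>\<^bsub>W\<^esub> f y"
    and "\<And>c x. x \<in> carrier V \<Longrightarrow> f (c \<odot>\<^bsub>V\<^esub> x) = c \<odot>\<^bsub>W\<^esub> f x"
  shows "f \<in> linear_maps V W"
  using assms by (auto simp: linear_maps_def)

lemma linear_mapsD:
  assumes "f \<in> linear_maps V W"
  shows "x \<in> carrier V \<Longrightarrow> f x \<in> carrier W"
    and "x \<in> carrier V \<Longrightarrow> y \<in> carrier V \<Longrightarrow> f (x \<oplus>\<^bsub>V\<^esub> y) = f x \<oplus>\<^bsub>W\<^esub> f y"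
    and "x \<in> carrier V \<Longrightarrow> f (c \<odot>\<^bsub>V\<^esub> x) = c \<odot>\<^bsub>W\<^esub> f x"
  using assms by (auto simp: linear_maps_def)

lemma linear_maps_zero:
  assumes "vspace V" "vspace W" "f \<in> linear_maps V W"
  shows "f \<zero>\<^bsub>V\<^esub> = \<zero>\<^bsub>W\<^esub>"
proof -
  interpret V: Module.module type_ring V by fact
  interpret W: Module.module type_ring W by fact
  have "f \<zero>\<^bsub>V\<^esub> = f (0 \<odot>\<^bsub>V\<^esub> \<zero>\<^bsub>V\<^esub>)"
    using V.smult_l_null[of "\<zero>\<^bsub>V\<^esub>"] by simp
  also have "\<dots> = 0 \<odot>\<^bsub>W\<^esub> f \<zero>\<^bsub>V\<^esub>"
    by (rule linear_mapsD(3)[OF assms(3)]) simp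
  also have "\<dots> = \<zero>\<^bsub>W\<^esub>"
    using W.smult_l_null[of "f \<zero>\<^bsub>V\<^esub>"] linear_mapsD(1)[OF assms(3)] by simp
  finally show ?thesis .
qed

lemma linear_maps_finsum:
  assumes V: "vspace V" and W: "vspace W" and f: "f \<in> linear_maps V W"
    and "finite A" "\<And>i. i \<in> A \<Longrightarrow> g i \<in> carrier V"
  shows "f (\<Oplus>\<^bsub>V\<^esub>i\<in>A. g i) = (\<Oplus>\<^bsub>W\<^esub>i\<in>A. f (g i))"
  using assms(4,5)
proof (induction A rule: finite_induct)
  case empty
  interpret V: Module.module type_ring V by fact
  interpret W: Module.module type_ring W by fact
  show ?case using linear_maps_zero[OF V W f] by simp
next
  case (insert a A)
  interpret V: Module.module type_ring V by fact
  interpret W: Module.module type_ring W by fact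
  have g: "g \<in> A \<rightarrow> carrier V" "g a \<in> carrier V" using insert by auto
  then have "(\<lambda>i. f (g i)) \<in> A \<rightarrow> carrier W" "f (g a) \<in> carrier W"
    using linear_mapsD(1)[OF f] by auto
  then show ?case
    using insert g linear_mapsD(2)[OF f] by (simp add: V.finsum_insert W.finsum_insert)
qed

lemma linear_maps_comp:
  "f \<in> linear_maps U V \<Longrightarrow> g \<in> linear_maps V W \<Longrightarrow> (\<lambda>x. g (f x)) \<in> linear_maps U W"
  by (rule linear_mapsI) (simp_all add: linear_mapsD)

lemma linear_maps_id: "id \<in> linear_maps V V" "(\<lambda>x. x) \<in> linear_maps V V"
  by (auto simp: linear_maps_def)

text \<open>
  Bilinearity is stated through partial applications, so that the factors can be handled one
  at a time.
\<close>

definition bilinear_map where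
  "bilinear_map V W U \<beta> \<longleftrightarrow> (\<forall>v\<in>carrier V. \<beta> v \<in> linear_maps W U) \<and>
     (\<forall>w\<in>carrier W. (\<lambda>v. \<beta> v w) \<in> linear_maps V U)"

lemma bilinear_mapD:
  assumes "bilinear_map V W U \<beta>"
  shows "v \<in> carrier V \<Longrightarrow> \<beta> v \<in> linear_maps W U"
    and "w \<in> carrier W \<Longrightarrow> (\<lambda>v. \<beta> v w) \<in> linear_maps V U"
    and "v \<in> carrier V \<Longrightarrow> w \<in> carrier W \<Longrightarrow> \<beta> v w \<in> carrier U"
  using assms by (auto simp: bilinear_map_def linear_maps_def)

lemma bilinear_map_comp:
  assumes "bilinear_map V W U \<beta>" "f \<in> linear_maps V' V" "g \<in> linear_maps W' W"
    "h \<in> linear_maps U U'"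
  shows "bilinear_map V' W' U' (\<lambda>v w. h (\<beta> (f v) (g w)))"
proof -
  have "(\<lambda>w. h (\<beta> (f v) (g w))) \<in> linear_maps W' U'" if "v \<in> carrier V'" for v
    using linear_maps_comp[OF linear_maps_comp[OF assms(3) bilinear_mapD(1)[OF assms(1)]] assms(4)]
      linear_mapsD(1)[OF assms(2) that] by blast
  moreover have "(\<lambda>v. h (\<beta> (f v) (g w))) \<in> linear_maps V' U'" if "w \<in> carrier W'" for w
    using linear_maps_comp[OF linear_maps_comp[OF assms(2) bilinear_mapD(2)[OF assms(1)]] assms(4)]
      linear_mapsD(1)[OF assms(3) that] by blast
  ultimately show ?thesis by (simp add: bilinear_map_def)
qed

section \<open>The tensor product\<close>

lemma lookup_pm_scale [simp]: "Poly_Mapping.lookup (pm_scale c u) p = c * Poly_Mapping.lookup u p"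
  by (simp add: pm_scale_def Poly_Mapping.map.rep_eq when_def)

interpretation pm: Vector_Spaces.vector_space pm_scale
  by unfold_locales (auto intro!: poly_mapping_eqI simp: lookup_add algebra_simps)

lemma pm_scale_single [simp]: "pm_scale c (Poly_Mapping.single p a) = Poly_Mapping.single p (c * a)"
  by (rule poly_mapping_eqI) (simp add: lookup_single when_def)

lemma keys_pm_scale: "Poly_Mapping.keys (pm_scale c u) \<subseteq> Poly_Mapping.keys u"
  by (auto simp: in_keys_iff)

lemma subspace_keys: "pm.subspace {u :: 'a \<Rightarrow>\<^sub>0 'k::field. Poly_Mapping.keys u \<subseteq> A}"
proof (rule pm.subspaceI)
  fix u v :: "'a \<Rightarrow>\<^sub>0 'k::field" and c
  assume *: "u \<in> {u. Poly_Mapping.keys u \<subseteq> A}"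
  then show "pm_scale c u \<in> {u. Poly_Mapping.keys u \<subseteq> A}"
    using keys_pm_scale[of c u] by simp
  assume "v \<in> {u. Poly_Mapping.keys u \<subseteq> A}"
  with * show "u + v \<in> {u. Poly_Mapping.keys u \<subseteq> A}"
    using Poly_Mapping.keys_add[of u v] by auto
qed simp

lemma subspace_tensor_null: "pm.subspace (tensor_null V W)"
  by (simp add: tensor_null_def)

lemma tensor_relators_keys:
  assumes "vspace V" "vspace W" "r \<in> tensor_relators V W"
  shows "Poly_Mapping.keys r \<subseteq> carrier V \<times> carrier W"
proof -
  interpret V: Module.module type_ring V by fact
  interpret W: Module.module type_ring W by fact
  have smult: "c \<odot>\<^bsub>V\<^esub> v \<in> carrier V" "d \<odot>\<^bsub>W\<^esub> w \<in> carrier W"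
    if "v \<in> carrier V" "w \<in> carrier W" for c v d w
    using that V.smult_closed[of c v] W.smult_closed[of d w] by auto
  have "u - v \<in> {u. Poly_Mapping.keys u \<subseteq> carrier V \<times> carrier W}"
    if "u \<in> {u. Poly_Mapping.keys u \<subseteq> carrier V \<times> carrier W}"
      "v \<in> {u. Poly_Mapping.keys u \<subseteq> carrier V \<times> carrier W}" for u v :: "_ \<Rightarrow>\<^sub>0 'a"
    using that by (rule pm.subspace_diff[OF subspace_keys])
  then show ?thesis
    using assms(3) unfolding tensor_relators_def
    by (elim UnE CollectE exE conjE) (simp_all add: smult)
qed

lemma tensor_null_keys:
  assumes "vspace V" "vspace W" "r \<in> tensor_null V W"
  shows "Poly_Mapping.keys r \<subseteq> carrier V \<times> carrier W"
proof -
  have "tensor_null V W \<subseteq> {u. Poly_Mapping.keys u \<subseteq> carrier V \<times> carrier W}"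
    unfolding tensor_null_def using tensor_relators_keys[OF assms(1,2)]
    by (intro pm.span_minimal subspace_keys) auto
  with assms(3) show ?thesis by auto
qed

lemma tensor_null_simps:
  "0 \<in> tensor_null V W"
  "a \<in> tensor_null V W \<Longrightarrow> b \<in> tensor_null V W \<Longrightarrow> a + b \<in> tensor_null V W"
  "a \<in> tensor_null V W \<Longrightarrow> b \<in> tensor_null V W \<Longrightarrow> a - b \<in> tensor_null V W"
  "a \<in> tensor_null V W \<Longrightarrow> - a \<in> tensor_null V W"
  "a \<in> tensor_null V W \<Longrightarrow> pm_scale c a \<in> tensor_null V W"
  using subspace_tensor_null[of V W]
  by (auto intro: pm.subspace_0 pm.subspace_add pm.subspace_diff pm.subspace_neg pm.subspace_scale)

lemma mem_tensor_class: "x \<in> tensor_class V W u \<longleftrightarrow> x - u \<in> tensor_null V W"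
  by (force simp: tensor_class_def)

lemma tensor_class_eq_iff: "tensor_class V W u = tensor_class V W v \<longleftrightarrow> u - v \<in> tensor_null V W"
proof
  assume "tensor_class V W u = tensor_class V W v"
  moreover have "u \<in> tensor_class V W u" by (simp add: mem_tensor_class tensor_null_simps)
  ultimately show "u - v \<in> tensor_null V W" by (simp add: mem_tensor_class)
next
  assume *: "u - v \<in> tensor_null V W"
  show "tensor_class V W u = tensor_class V W v"
  proof (rule Set.set_eqI)
    fix x
    have "x - v = (x - u) + (u - v)" "x - u = (x - v) - (u - v)" by auto
    then show "x \<in> tensor_class V W u \<longleftrightarrow> x \<in> tensor_class V W v"
      unfolding mem_tensor_class using * tensor_null_simps(2,3) by metis
  qed
qed

lemma tensor_space_ops:
  shows "carrier (tensor_space V W) =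
      tensor_class V W ` {u. Poly_Mapping.keys u \<subseteq> carrier V \<times> carrier W}"
    and "\<zero>\<^bsub>tensor_space V W\<^esub> = tensor_class V W 0"
    and "tensor_class V W u \<oplus>\<^bsub>tensor_space V W\<^esub> tensor_class V W v = tensor_class V W (u + v)"
    and "c \<odot>\<^bsub>tensor_space V W\<^esub> tensor_class V W u = tensor_class V W (pm_scale c u)"
proof -
  show "\<zero>\<^bsub>tensor_space V W\<^esub> = tensor_class V W 0"
    by (simp add: tensor_space_def tensor_class_def)
  show "tensor_class V W u \<oplus>\<^bsub>tensor_space V W\<^esub> tensor_class V W v = tensor_class V W (u + v)"
  proof (rule Set.set_eqI, rule iffI)
    fix x assume "x \<in> tensor_class V W u \<oplus>\<^bsub>tensor_space V W\<^esub> tensor_class V W v"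
    then obtain a b where "x = (u + a) + (v + b)" "a \<in> tensor_null V W" "b \<in> tensor_null V W"
      by (auto simp: tensor_space_def tensor_class_def)
    moreover from this have "x - (u + v) = a + b" by (simp add: algebra_simps)
    ultimately show "x \<in> tensor_class V W (u + v)"
      by (simp add: mem_tensor_class tensor_null_simps)
  next
    fix x assume x: "x \<in> tensor_class V W (u + v)"
    have "x - v \<in> tensor_class V W u"
      using x by (simp add: mem_tensor_class algebra_simps)
    moreover have "v \<in> tensor_class V W v" by (simp add: mem_tensor_class tensor_null_simps)
    ultimately show "x \<in> tensor_class V W u \<oplus>\<^bsub>tensor_space V W\<^esub> tensor_class V W v"
      unfolding tensor_space_def by simp (metis diff_add_cancel)
  qed
  show "c \<odot>\<^bsub>tensor_space V W\<^esub> tensor_class V W u = tensor_class V W (pm_scale c u)"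
  proof (rule Set.set_eqI, rule iffI)
    fix x assume "x \<in> c \<odot>\<^bsub>tensor_space V W\<^esub> tensor_class V W u"
    then obtain a b where "x = pm_scale c (u + a) + b" "a \<in> tensor_null V W" "b \<in> tensor_null V W"
      by (auto simp: tensor_space_def tensor_class_def)
    then have "x - pm_scale c u = pm_scale c a + b"
      by (simp add: pm.scale_right_distrib algebra_simps)
    with \<open>a \<in> _\<close> \<open>b \<in> _\<close> show "x \<in> tensor_class V W (pm_scale c u)"
      by (simp add: mem_tensor_class tensor_null_simps)
  next
    fix x assume x: "x \<in> tensor_class V W (pm_scale c u)"
    then obtain n where "x = pm_scale c u + n" "n \<in> tensor_null V W"
      by (auto simp: tensor_class_def)
    moreover have "u \<in> tensor_class V W u" by (simp add: mem_tensor_class tensor_null_simps)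
    ultimately show "x \<in> c \<odot>\<^bsub>tensor_space V W\<^esub> tensor_class V W u"
      unfolding tensor_space_def by auto
  qed
qed (simp add: tensor_space_def)

lemma tensor_vspace: "vspace (tensor_space V W)"
proof -
  have closed: "Poly_Mapping.keys (u + v) \<subseteq> A" "Poly_Mapping.keys (pm_scale c u) \<subseteq> A"
    if "Poly_Mapping.keys u \<subseteq> A" "Poly_Mapping.keys v \<subseteq> A" for A u v and c :: 'a
    using subspace_keys[of A, unfolded pm.subspace_def] that by blast+
  show ?thesis
    by (rule vspaceI)
       (auto simp: tensor_space_ops closed algebra_simps pm.scale_left_distrib
          pm.scale_right_distrib intro!: image_eqI[OF refl])
qed

lemma pure_tensor_closed:
  "v \<in> carrier V \<Longrightarrow> w \<in> carrier W \<Longrightarrow> pure_tensor V W v w \<in> carrier (tensor_space V W)"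
  by (auto simp: pure_tensor_def tensor_space_ops)

lemma pure_tensor_bilinear: "bilinear_map V W (tensor_space V W) (pure_tensor V W)"
proof -
  have *: "r \<in> tensor_relators V W \<Longrightarrow> r \<in> tensor_null V W" for r
    by (simp add: tensor_null_def pm.span_base)
  have add: "tensor_class V W a = tensor_class V W (b + c)" if "a - b - c \<in> tensor_relators V W"
    for a b c
    unfolding tensor_class_eq_iff using *[OF that] by (simp add: algebra_simps)
  have smult: "tensor_class V W a = tensor_class V W b" if "a - b \<in> tensor_relators V W" for a b
    unfolding tensor_class_eq_iff using *[OF that] .
  show ?thesis
    unfolding bilinear_map_def
  proof (intro conjI ballI)
    fix v assume v: "v \<in> carrier V"
    show "pure_tensor V W v \<in> linear_maps W (tensor_space V W)"
    proof (rule linear_mapsI)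
      fix w w' c assume w: "w \<in> carrier W"
      show "pure_tensor V W v w \<in> carrier (tensor_space V W)" using v w by (rule pure_tensor_closed)
      show "pure_tensor V W v (c \<odot>\<^bsub>W\<^esub> w) = c \<odot>\<^bsub>tensor_space V W\<^esub> pure_tensor V W v w"
        unfolding pure_tensor_def tensor_space_ops
        by (rule smult) (use v w in \<open>auto simp: tensor_relators_def\<close>)
      assume w': "w' \<in> carrier W"
      show "pure_tensor V W v (w \<oplus>\<^bsub>W\<^esub> w') =
          pure_tensor V W v w \<oplus>\<^bsub>tensor_space V W\<^esub> pure_tensor V W v w'"
        unfolding pure_tensor_def tensor_space_ops
        by (rule add) (use v w w' in \<open>auto simp: tensor_relators_def\<close>)
    qed
  next
    fix w assume w: "w \<in> carrier W"
    show "(\<lambda>v. pure_tensor V W v w) \<in> linear_maps V (tensor_space V W)"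
    proof (rule linear_mapsI)
      fix v v' c assume v: "v \<in> carrier V"
      show "pure_tensor V W v w \<in> carrier (tensor_space V W)" using v w by (rule pure_tensor_closed)
      show "pure_tensor V W (c \<odot>\<^bsub>V\<^esub> v) w = c \<odot>\<^bsub>tensor_space V W\<^esub> pure_tensor V W v w"
        unfolding pure_tensor_def tensor_space_ops
        by (rule smult) (use v w in \<open>auto simp: tensor_relators_def\<close>)
      assume v': "v' \<in> carrier V"
      show "pure_tensor V W (v \<oplus>\<^bsub>V\<^esub> v') w =
          pure_tensor V W v w \<oplus>\<^bsub>tensor_space V W\<^esub> pure_tensor V W v' w"
        unfolding pure_tensor_def tensor_space_ops
        by (rule add) (use v v' w in \<open>auto simp: tensor_relators_def\<close>)
    qed
  qed
qed

text \<open>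
  Scalars can be moved into the first factor, so every element of the tensor product is a sum of
  pure tensors, without coefficients.
\<close>

lemma tensor_induct [consumes 3, case_names pure add]:
  assumes "t \<in> carrier (tensor_space V W)" and V: "vspace V" and W: "vspace W"
    and pure: "\<And>v w. v \<in> carrier V \<Longrightarrow> w \<in> carrier W \<Longrightarrow> P (pure_tensor V W v w)"
    and add: "\<And>s t. s \<in> carrier (tensor_space V W) \<Longrightarrow> t \<in> carrier (tensor_space V W) \<Longrightarrow>
      P s \<Longrightarrow> P t \<Longrightarrow> P (s \<oplus>\<^bsub>tensor_space V W\<^esub> t)"
  shows "P t"
proof -
  interpret V: Module.module type_ring V by fact
  interpret W: Module.module type_ring W by fact
  have single: "tensor_class V W (Poly_Mapping.single (v, w) c) = pure_tensor V W (c \<odot>\<^bsub>V\<^esub> v) w"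
    if "v \<in> carrier V" "w \<in> carrier W" for v w c
    using linear_mapsD(3)[OF bilinear_mapD(2)[OF pure_tensor_bilinear[of V W] that(2)] that(1),
      of c]
    by (simp add: pure_tensor_def tensor_space_ops)
  have "P (tensor_class V W u)"
    if "finite A" "A \<subseteq> carrier V \<times> carrier W" "Poly_Mapping.keys u \<subseteq> A" for A u
    using that
  proof (induction A arbitrary: u rule: finite_induct)
    case empty
    then have "u = Poly_Mapping.single (\<zero>\<^bsub>V\<^esub>, \<zero>\<^bsub>W\<^esub>) 0" by simp
    then show ?case
      using single[of "\<zero>\<^bsub>V\<^esub>" "\<zero>\<^bsub>W\<^esub>" 0] pure[of "0 \<odot>\<^bsub>V\<^esub> \<zero>\<^bsub>V\<^esub>" "\<zero>\<^bsub>W\<^esub>"] V.smult_closed[of 0 "\<zero>\<^bsub>V\<^esub>"]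
      by simp
  next
    case (insert p A)
    obtain v w where p: "p = (v, w)" "v \<in> carrier V" "w \<in> carrier W" using insert.prems by auto
    let ?m = "Poly_Mapping.single p (Poly_Mapping.lookup u p)"
    have keys: "Poly_Mapping.keys (u - ?m) \<subseteq> A"
      using insert.prems by (auto simp: in_keys_iff lookup_minus lookup_single when_def
        split: if_splits)
    then have "P (tensor_class V W (u - ?m))" by (intro insert.IH) (use insert.prems in auto)
    moreover have "P (tensor_class V W ?m)"
      unfolding p(1) using single[OF p(2,3)] pure V.smult_closed p(2,3) by simp
    moreover have "tensor_class V W u =
        tensor_class V W (u - ?m) \<oplus>\<^bsub>tensor_space V W\<^esub> tensor_class V W ?m"
      by (simp add: tensor_space_ops)
    moreover have "tensor_class V W (u - ?m) \<in> carrier (tensor_space V W)"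
      using keys insert.prems by (auto simp: tensor_space_ops)
    moreover have "tensor_class V W ?m \<in> carrier (tensor_space V W)"
      using insert.prems by (auto simp: tensor_space_ops)
    ultimately show ?case using add by simp
  qed
  note coset = this
  obtain u where u: "t = tensor_class V W u" "Poly_Mapping.keys u \<subseteq> carrier V \<times> carrier W"
    using assms(1) unfolding tensor_space_ops(1) by blast
  show ?thesis unfolding u(1) by (rule coset[OF finite_keys u(2) subset_refl])
qed

lemma linear_maps_tensor_eqI:
  assumes "vspace V" "vspace W" "f \<in> linear_maps (tensor_space V W) U"
    "g \<in> linear_maps (tensor_space V W) U" "t \<in> carrier (tensor_space V W)"
    and "\<And>v w. v \<in> carrier V \<Longrightarrow> w \<in> carrier W \<Longrightarrow>
      f (pure_tensor V W v w) = g (pure_tensor V W v w)"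
  shows "f t = g t"
  using assms(5,1,2)
proof (induction rule: tensor_induct)
  case (add s t)
  then show ?case by (simp add: linear_mapsD(2)[OF assms(3)] linear_mapsD(2)[OF assms(4)])
qed (fact assms(6))

section \<open>The universal property of the tensor product\<close>

text \<open>
  The extension of \<open>\<beta>\<close> to the free vector space on pairs, of which \<open>tensor_lift\<close> is the value at
  some representative of a coset.
\<close>

definition free_lift where
  "free_lift U \<beta> u =
     (\<Oplus>\<^bsub>U\<^esub>p\<in>Poly_Mapping.keys u. Poly_Mapping.lookup u p \<odot>\<^bsub>U\<^esub> \<beta> (fst p) (snd p))"

context
  fixes V :: "('k::field, 'v, 'l) module_scheme" and W :: "('k, 'w, 'm) module_scheme"
    and U :: "('k, 'u, 'n) module_scheme" and \<beta>
  assumes V: "vspace V" and W: "vspace W" and U: "vspace U" and \<beta>: "bilinear_map V W U \<beta>"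
begin

interpretation U: Module.module type_ring U by (rule U)

text \<open>
  Summing over a larger set of pairs gives sums with a common index set, for which additivity in
  \<open>u\<close> is a termwise statement.
\<close>

lemma free_lift_superset:
  assumes "finite A" "A \<subseteq> carrier V \<times> carrier W" "Poly_Mapping.keys u \<subseteq> A"
  shows "free_lift U \<beta> u = (\<Oplus>\<^bsub>U\<^esub>p\<in>A. Poly_Mapping.lookup u p \<odot>\<^bsub>U\<^esub> \<beta> (fst p) (snd p))"
  unfolding free_lift_def
proof (rule U.add.finprod_mono_neutral_cong_left)
  have *: "\<beta> (fst p) (snd p) \<in> carrier U" if "p \<in> A" for p
    using bilinear_mapD(3)[OF \<beta>] assms(2) that by (cases p) auto
  show "Poly_Mapping.lookup u p \<odot>\<^bsub>U\<^esub> \<beta> (fst p) (snd p) = \<zero>\<^bsub>U\<^esub>"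
    if "p \<in> A - Poly_Mapping.keys u" for p
    using that * U.smult_l_null by (simp add: in_keys_iff)
  show "(\<lambda>p. Poly_Mapping.lookup u p \<odot>\<^bsub>U\<^esub> \<beta> (fst p) (snd p)) \<in> A \<rightarrow> carrier U"
    using * U.smult_closed by auto
qed (use assms in auto)

lemma free_lift_add:
  assumes "Poly_Mapping.keys u \<subseteq> carrier V \<times> carrier W"
    "Poly_Mapping.keys v \<subseteq> carrier V \<times> carrier W"
  shows "free_lift U \<beta> (u + v) = free_lift U \<beta> u \<oplus>\<^bsub>U\<^esub> free_lift U \<beta> v"
proof -
  let ?A = "Poly_Mapping.keys u \<union> Poly_Mapping.keys v"
  have A: "finite ?A" "?A \<subseteq> carrier V \<times> carrier W" using assms by auto
  have "\<beta> (fst p) (snd p) \<in> carrier U" if "p \<in> ?A" for p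
    using bilinear_mapD(3)[OF \<beta>] A(2) that by (cases p) auto
  then have closed: "c \<odot>\<^bsub>U\<^esub> \<beta> (fst p) (snd p) \<in> carrier U" if "p \<in> ?A" for p c
    using that U.smult_closed by simp
  have "free_lift U \<beta> (u + v) = (\<Oplus>\<^bsub>U\<^esub>p\<in>?A. Poly_Mapping.lookup (u + v) p \<odot>\<^bsub>U\<^esub> \<beta> (fst p) (snd p))"
    by (rule free_lift_superset[OF A]) (rule Poly_Mapping.keys_add)
  also have "\<dots> = (\<Oplus>\<^bsub>U\<^esub>p\<in>?A. Poly_Mapping.lookup u p \<odot>\<^bsub>U\<^esub> \<beta> (fst p) (snd p) \<oplus>\<^bsub>U\<^esub>
      Poly_Mapping.lookup v p \<odot>\<^bsub>U\<^esub> \<beta> (fst p) (snd p))"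
    using U.smult_l_distr closed bilinear_mapD(3)[OF \<beta>] A(2)
    by (intro U.finsum_cong') (auto simp: lookup_add subset_iff)
  also have "\<dots> = (\<Oplus>\<^bsub>U\<^esub>p\<in>?A. Poly_Mapping.lookup u p \<odot>\<^bsub>U\<^esub> \<beta> (fst p) (snd p)) \<oplus>\<^bsub>U\<^esub>
      (\<Oplus>\<^bsub>U\<^esub>p\<in>?A. Poly_Mapping.lookup v p \<odot>\<^bsub>U\<^esub> \<beta> (fst p) (snd p))"
    using closed by (intro U.finsum_addf) auto
  also have "\<dots> = free_lift U \<beta> u \<oplus>\<^bsub>U\<^esub> free_lift U \<beta> v"
    by (simp add: free_lift_superset[OF A])
  finally show ?thesis .
qed

lemma free_lift_scale:
  assumes "Poly_Mapping.keys u \<subseteq> carrier V \<times> carrier W"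
  shows "free_lift U \<beta> (pm_scale c u) = c \<odot>\<^bsub>U\<^esub> free_lift U \<beta> u"
proof -
  let ?A = "Poly_Mapping.keys u"
  have \<beta>': "\<beta> (fst p) (snd p) \<in> carrier U" if "p \<in> ?A" for p
    using bilinear_mapD(3)[OF \<beta>] assms that by (cases p) auto
  then have closed: "c \<odot>\<^bsub>U\<^esub> \<beta> (fst p) (snd p) \<in> carrier U" if "p \<in> ?A" for p c
    using that U.smult_closed by simp
  have "free_lift U \<beta> (pm_scale c u) = (\<Oplus>\<^bsub>U\<^esub>p\<in>?A. Poly_Mapping.lookup (pm_scale c u) p \<odot>\<^bsub>U\<^esub>
    \<beta> (fst p) (snd p))"
    by (rule free_lift_superset) (use assms keys_pm_scale[of c u] in auto)
  also have "\<dots> = (\<Oplus>\<^bsub>U\<^esub>p\<in>?A. c \<odot>\<^bsub>U\<^esub> (Poly_Mapping.lookup u p \<odot>\<^bsub>U\<^esub> \<beta> (fst p) (snd p)))"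
    using U.smult_assoc1 closed \<beta>' by (intro U.finsum_cong') auto
  also have "\<dots> = c \<odot>\<^bsub>U\<^esub> free_lift U \<beta> u"
    unfolding free_lift_def using closed by (subst U.finsum_smult_ldistr) auto
  finally show ?thesis .
qed

lemma free_lift_single:
  assumes "v \<in> carrier V" "w \<in> carrier W"
  shows "free_lift U \<beta> (Poly_Mapping.single (v, w) c) = c \<odot>\<^bsub>U\<^esub> \<beta> v w"
proof -
  have "\<beta> v w \<in> carrier U" using bilinear_mapD(3)[OF \<beta>] assms by simp
  then show ?thesis
    using free_lift_superset[of "{(v, w)}" "Poly_Mapping.single (v, w) c"] assms U.smult_closed
    by (simp add: U.finsum_insert)
qed

text \<open>
  The kernel of the extension is a subspace that contains the relators because \<open>\<beta>\<close> is bilinear.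
  This is what makes the choice of a representative in \<open>tensor_lift\<close> immaterial.
\<close>

lemma free_lift_tensor_null:
  assumes "r \<in> tensor_null V W"
  shows "free_lift U \<beta> r = \<zero>\<^bsub>U\<^esub>"
proof -
  interpret V: Module.module type_ring V by (rule V)
  interpret W: Module.module type_ring W by (rule W)
  let ?S = "{u. Poly_Mapping.keys u \<subseteq> carrier V \<times> carrier W}"
  let ?N = "{u \<in> ?S. free_lift U \<beta> u = \<zero>\<^bsub>U\<^esub>}"
  have zero: "free_lift U \<beta> 0 = \<zero>\<^bsub>U\<^esub>"
    unfolding free_lift_def by simp
  have smult_zero: "c \<odot>\<^bsub>U\<^esub> \<zero>\<^bsub>U\<^esub> = \<zero>\<^bsub>U\<^esub>" for c using U.smult_r_null[of c] by simp
  have sub: "pm.subspace ?N"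
  proof (rule pm.subspaceI)
    fix u v c assume u: "u \<in> ?N"
    with pm.subspace_scale[OF subspace_keys, of u "carrier V \<times> carrier W" c]
    show "pm_scale c u \<in> ?N" by (simp add: free_lift_scale smult_zero)
    assume "v \<in> ?N"
    with u pm.subspace_add[OF subspace_keys, of u "carrier V \<times> carrier W" v]
    show "u + v \<in> ?N" by (simp add: free_lift_add)
  qed (simp add: zero)
  have diff: "free_lift U \<beta> (u - v) = free_lift U \<beta> u \<oplus>\<^bsub>U\<^esub> (-1) \<odot>\<^bsub>U\<^esub> free_lift U \<beta> v"
    if "u \<in> ?S" "v \<in> ?S" for u v
  proof -
    have "u - v = u + pm_scale (-1) v" by simp
    moreover have "Poly_Mapping.keys (pm_scale (-1) v) \<subseteq> carrier V \<times> carrier W"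
      using that keys_pm_scale[of "-1" v] by auto
    ultimately show ?thesis using that by (simp only: free_lift_add free_lift_scale mem_Collect_eq)
  qed
  have cancel: "x \<oplus>\<^bsub>U\<^esub> (-1) \<odot>\<^bsub>U\<^esub> x = \<zero>\<^bsub>U\<^esub>" if "x \<in> carrier U" for x
    using U.smult_l_distr[of 1 "-1" x] U.smult_one[of x] U.smult_l_null[of x] that by simp
  have "u - v \<in> ?N" if "u \<in> ?S" "v \<in> ?S" "free_lift U \<beta> u = free_lift U \<beta> v"
    "free_lift U \<beta> u \<in> carrier U" for u v
    using that pm.subspace_diff[OF subspace_keys, of u "carrier V \<times> carrier W" v] diff[of u v]
      cancel by auto
  note diffI = this
  have smults: "c \<odot>\<^bsub>V\<^esub> v \<in> carrier V" "d \<odot>\<^bsub>W\<^esub> w \<in> carrier W"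
    if "v \<in> carrier V" "w \<in> carrier W" for c v d w
    using that V.smult_closed[of c v] W.smult_closed[of d w] by auto
  have one: "1 \<odot>\<^bsub>U\<^esub> x = x" if "x \<in> carrier U" for x using U.smult_one[of x] that by simp
  have lin: "\<beta> (v \<oplus>\<^bsub>V\<^esub> v') w = \<beta> v w \<oplus>\<^bsub>U\<^esub> \<beta> v' w" "\<beta> v (w \<oplus>\<^bsub>W\<^esub> w') = \<beta> v w \<oplus>\<^bsub>U\<^esub> \<beta> v w'"
    "\<beta> (c \<odot>\<^bsub>V\<^esub> v) w = c \<odot>\<^bsub>U\<^esub> \<beta> v w" "\<beta> v (c \<odot>\<^bsub>W\<^esub> w) = c \<odot>\<^bsub>U\<^esub> \<beta> v w"
    "\<beta> v w \<in> carrier U" "c \<odot>\<^bsub>U\<^esub> \<beta> v w \<in> carrier U"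
    if "v \<in> carrier V" "w \<in> carrier W" "v' \<in> carrier V" "w' \<in> carrier W" for v v' w w' c
    using linear_mapsD(2,3)[OF bilinear_mapD(1)[OF \<beta> that(1)]]
      linear_mapsD(2,3)[OF bilinear_mapD(2)[OF \<beta> that(2)]]
      bilinear_mapD(3)[OF \<beta> that(1,2)] U.smult_closed that by auto
  have "tensor_relators V W \<subseteq> ?N"
  proof
    fix r assume "r \<in> tensor_relators V W"
    then consider
      (1) v v' w where "r = Poly_Mapping.single (v \<oplus>\<^bsub>V\<^esub> v', w) 1 - (Poly_Mapping.single (v, w) 1
        + Poly_Mapping.single (v', w) 1)" "v \<in> carrier V" "v' \<in> carrier V" "w \<in> carrier W"
      | (2) v w w' where "r = Poly_Mapping.single (v, w \<oplus>\<^bsub>W\<^esub> w') 1 - (Poly_Mapping.single (v, w) 1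
        + Poly_Mapping.single (v, w') 1)" "v \<in> carrier V" "w \<in> carrier W" "w' \<in> carrier W"
      | (3) c v w where "r = Poly_Mapping.single (c \<odot>\<^bsub>V\<^esub> v, w) 1 - Poly_Mapping.single (v, w) c"
        "v \<in> carrier V" "w \<in> carrier W"
      | (4) c v w where "r = Poly_Mapping.single (v, c \<odot>\<^bsub>W\<^esub> w) 1 - Poly_Mapping.single (v, w) c"
        "v \<in> carrier V" "w \<in> carrier W"
      unfolding tensor_relators_def diff_diff_eq by blast
    then show "r \<in> ?N"
    proof cases
      case 1
      have "Poly_Mapping.single (v, w) (1::'k) + Poly_Mapping.single (v', w) 1 \<in> ?S"
        by (rule pm.subspace_add[OF subspace_keys]) (use 1 in auto)
      then show ?thesis
        unfolding 1(1) by (intro diffI) (use 1 in \<open>simp_all add: free_lift_single free_lift_add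
          lin one\<close>)
    next
      case 2
      have "Poly_Mapping.single (v, w) (1::'k) + Poly_Mapping.single (v, w') 1 \<in> ?S"
        by (rule pm.subspace_add[OF subspace_keys]) (use 2 in auto)
      then show ?thesis
        unfolding 2(1) by (intro diffI) (use 2 in \<open>simp_all add: free_lift_single free_lift_add
          lin one\<close>)
    next
      case 3
      then show ?thesis
        unfolding 3(1) by (intro diffI) (simp_all add: free_lift_single lin one smults)
    next
      case 4
      then show ?thesis
        unfolding 4(1) by (intro diffI) (simp_all add: free_lift_single lin one smults)
    qed
  qed
  then have "tensor_null V W \<subseteq> ?N" unfolding tensor_null_def by (rule pm.span_minimal[OF _ sub])
  with assms show ?thesis by auto
qed

lemma tensor_lift_class:
  assumes "Poly_Mapping.keys u \<subseteq> carrier V \<times> carrier W"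
  shows "tensor_lift U \<beta> (tensor_class V W u) = free_lift U \<beta> u"
proof -
  define u' where "u' = (SOME x. x \<in> tensor_class V W u)"
  have "u \<in> tensor_class V W u" by (simp add: mem_tensor_class tensor_null_simps)
  then have "u' \<in> tensor_class V W u" unfolding u'_def by (rule someI)
  then have n: "u' - u \<in> tensor_null V W" by (simp add: mem_tensor_class)
  have "free_lift U \<beta> u \<in> carrier U"
    unfolding free_lift_def
    by (rule U.finsum_closed) (use U.smult_closed bilinear_mapD(3)[OF \<beta>] assms in auto)
  moreover have "free_lift U \<beta> u' = free_lift U \<beta> (u + (u' - u))" by simp
  ultimately have "free_lift U \<beta> u' = free_lift U \<beta> u"
    using free_lift_add[OF assms tensor_null_keys[OF V W n]] free_lift_tensor_null[OF n] by simp
  then show ?thesis unfolding tensor_lift_def Let_def free_lift_def u'_def .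
qed

lemma tensor_lift_linear: "tensor_lift U \<beta> \<in> linear_maps (tensor_space V W) U"
proof (rule linear_mapsI)
  fix t s c assume t: "t \<in> carrier (tensor_space V W)"
  then obtain u where u: "t = tensor_class V W u" "Poly_Mapping.keys u \<subseteq> carrier V \<times> carrier W"
    by (auto simp: tensor_space_ops)
  show "tensor_lift U \<beta> t \<in> carrier U"
    unfolding u(1) tensor_lift_class[OF u(2)] unfolding free_lift_def
    by (rule U.finsum_closed) (use U.smult_closed bilinear_mapD(3)[OF \<beta>] u(2) in auto)
  have "Poly_Mapping.keys (pm_scale c u) \<subseteq> carrier V \<times> carrier W"
    using keys_pm_scale[of c u] u(2) by auto
  then show "tensor_lift U \<beta> (c \<odot>\<^bsub>tensor_space V W\<^esub> t) = c \<odot>\<^bsub>U\<^esub> tensor_lift U \<beta> t"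
    by (simp add: u tensor_space_ops tensor_lift_class free_lift_scale)
  assume "s \<in> carrier (tensor_space V W)"
  then obtain v where v: "s = tensor_class V W v" "Poly_Mapping.keys v \<subseteq> carrier V \<times> carrier W"
    by (auto simp: tensor_space_ops)
  have "Poly_Mapping.keys (u + v) \<subseteq> carrier V \<times> carrier W"
    using Poly_Mapping.keys_add[of u v] u(2) v(2) by auto
  then show "tensor_lift U \<beta> (t \<oplus>\<^bsub>tensor_space V W\<^esub> s) = tensor_lift U \<beta> t \<oplus>\<^bsub>U\<^esub> tensor_lift U \<beta> s"
    using u v by (simp add: tensor_space_ops tensor_lift_class free_lift_add)
qed

lemma tensor_lift_pure:
  assumes "v \<in> carrier V" "w \<in> carrier W"
  shows "tensor_lift U \<beta> (pure_tensor V W v w) = \<beta> v w"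
proof -
  have "Poly_Mapping.keys (Poly_Mapping.single (v, w) (1::'k)) \<subseteq> carrier V \<times> carrier W"
    using assms by simp
  then show ?thesis
    using assms U.smult_one[of "\<beta> v w"] bilinear_mapD(3)[OF \<beta> assms]
    by (simp add: pure_tensor_def tensor_lift_class free_lift_single)
qed

end

text \<open>
  Lifts can thus be nested: a multilinear map is lifted one pair of factors at a time, with the
  remaining arguments as parameters. Rebracketing and the middle swap are both built in this way.
\<close>

lemma tensor_lift_parameter:
  assumes S: "vspace S" and V: "vspace V" and W: "vspace W" and U: "vspace U"
    and X: "X \<in> carrier (tensor_space V W)"
    and bil: "\<And>s. s \<in> carrier S \<Longrightarrow> bilinear_map V W U (\<gamma> s)"
    and lin: "\<And>v w. v \<in> carrier V \<Longrightarrow> w \<in> carrier W \<Longrightarrow> (\<lambda>s. \<gamma> s v w) \<in> linear_maps S U"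
  shows "(\<lambda>s. tensor_lift U (\<gamma> s) X) \<in> linear_maps S U"
proof (rule linear_mapsI)
  interpret S: Module.module type_ring S by (rule S)
  interpret U: Module.module type_ring U by (rule U)
  note lift_lin = tensor_lift_linear[OF V W U bil]
  note lift_pure = tensor_lift_pure[OF V W U bil]
  fix s s' c assume s: "s \<in> carrier S"
  show "tensor_lift U (\<gamma> s) X \<in> carrier U"
    by (rule linear_mapsD(1)[OF lift_lin[OF s] X])
  have cs: "c \<odot>\<^bsub>S\<^esub> s \<in> carrier S" using S.smult_closed[of c s] s by simp
  show "tensor_lift U (\<gamma> (c \<odot>\<^bsub>S\<^esub> s)) X = c \<odot>\<^bsub>U\<^esub> tensor_lift U (\<gamma> s) X"
    using X V W
  proof (induction rule: tensor_induct)
    case (pure v w)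
    then show ?case by (simp add: lift_pure[OF cs] lift_pure[OF s] linear_mapsD(3)[OF lin s])
  next
    case (add a b)
    then show ?case
      using U.smult_r_distr[of c "tensor_lift U (\<gamma> s) a" "tensor_lift U (\<gamma> s) b"]
      by (simp add: linear_mapsD(1,2)[OF lift_lin[OF cs]] linear_mapsD(1,2)[OF lift_lin[OF s]])
  qed
  assume s': "s' \<in> carrier S"
  have ss: "s \<oplus>\<^bsub>S\<^esub> s' \<in> carrier S" using s s' by simp
  show "tensor_lift U (\<gamma> (s \<oplus>\<^bsub>S\<^esub> s')) X = tensor_lift U (\<gamma> s) X \<oplus>\<^bsub>U\<^esub> tensor_lift U (\<gamma> s') X"
    using X V W
  proof (induction rule: tensor_induct)
    case (pure v w)
    then show ?case
      by (simp add: lift_pure[OF ss] lift_pure[OF s] lift_pure[OF s'] linear_mapsD(2)[OF lin s s'])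
  next
    case (add a b)
    then show ?case
      by (simp add: linear_mapsD(1,2)[OF lift_lin[OF ss]] linear_mapsD(1,2)[OF lift_lin[OF s]]
          linear_mapsD(1,2)[OF lift_lin[OF s']] U.add.m_ac)
  qed
qed

section \<open>Functoriality, rebracketing and the middle swap\<close>

lemma tensor_map_bilinear:
  assumes "f \<in> linear_maps V V'" "g \<in> linear_maps W W'"
  shows "bilinear_map V W (tensor_space V' W') (\<lambda>v w. pure_tensor V' W' (f v) (g w))"
  using bilinear_map_comp[OF pure_tensor_bilinear assms linear_maps_id(2)] .

lemma tensor_map_linear:
  assumes "vspace V" "vspace W" "f \<in> linear_maps V V'" "g \<in> linear_maps W W'"
  shows "tensor_map V' W' f g \<in> linear_maps (tensor_space V W) (tensor_space V' W')"
  unfolding tensor_map_def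
  by (rule tensor_lift_linear[OF assms(1,2) tensor_vspace tensor_map_bilinear[OF assms(3,4)]])

lemma tensor_map_pure:
  assumes "vspace V" "vspace W" "f \<in> linear_maps V V'" "g \<in> linear_maps W W'"
    "v \<in> carrier V" "w \<in> carrier W"
  shows "tensor_map V' W' f g (pure_tensor V W v w) = pure_tensor V' W' (f v) (g w)"
  unfolding tensor_map_def
  by (rule tensor_lift_pure[OF assms(1,2) tensor_vspace
    tensor_map_bilinear[OF assms(3,4)] assms(5,6)])

context
  fixes U :: "('k::field, 'u, 'l) module_scheme" and V :: "('k, 'v, 'm) module_scheme"
    and W :: "('k, 'w, 'n) module_scheme"
  assumes U: "vspace U" and V: "vspace V" and W: "vspace W"
begin

abbreviation (input) "assoc_target \<equiv> tensor_space U (tensor_space V W)"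
abbreviation (input) "assoc_pure \<equiv> \<lambda>u v w. pure_tensor U (tensor_space V W) u (pure_tensor V W v w)"

lemma assoc_inner_bilinear:
  assumes "w \<in> carrier W"
  shows "bilinear_map U V assoc_target (\<lambda>u v. assoc_pure u v w)"
  using bilinear_map_comp[OF pure_tensor_bilinear linear_maps_id(2)
      bilinear_mapD(2)[OF pure_tensor_bilinear assms] linear_maps_id(2)] .

lemma assoc_outer_bilinear:
  "bilinear_map (tensor_space U V) W assoc_target (\<lambda>X w. tensor_lift assoc_target
    (\<lambda>u v. assoc_pure u v w) X)"
  unfolding bilinear_map_def
proof (intro conjI ballI)
  fix X assume "X \<in> carrier (tensor_space U V)"
  then show "(\<lambda>w. tensor_lift assoc_target (\<lambda>u v. assoc_pure u v w) X) \<in> linear_maps W assoc_target"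
  proof (rule tensor_lift_parameter[OF W U V tensor_vspace])
    show "(\<lambda>w. assoc_pure u v w) \<in> linear_maps W assoc_target" if "u \<in> carrier U" "v \<in> carrier V"
      for u v
      by (rule linear_maps_comp[OF bilinear_mapD(1)[OF pure_tensor_bilinear that(2)]
            bilinear_mapD(1)[OF pure_tensor_bilinear that(1)]])
  qed (rule assoc_inner_bilinear)
next
  fix w assume "w \<in> carrier W"
  then show "(\<lambda>X. tensor_lift assoc_target (\<lambda>u v. assoc_pure u v w) X)
    \<in> linear_maps (tensor_space U V) assoc_target"
    by (intro tensor_lift_linear[OF U V tensor_vspace] assoc_inner_bilinear)
qed

lemma tensor_assoc_linear:
  "tensor_assoc U V W \<in> linear_maps (tensor_space (tensor_space U V) W) assoc_target"
  unfolding tensor_assoc_def Let_def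
  by (rule tensor_lift_linear[OF tensor_vspace W tensor_vspace assoc_outer_bilinear])

lemma tensor_assoc_pure:
  assumes "u \<in> carrier U" "v \<in> carrier V" "w \<in> carrier W"
  shows "tensor_assoc U V W (pure_tensor (tensor_space U V) W (pure_tensor U V u v) w) =
    assoc_pure u v w"
  unfolding tensor_assoc_def Let_def
  by (simp add: tensor_lift_pure[OF tensor_vspace W tensor_vspace assoc_outer_bilinear]
      tensor_lift_pure[OF U V tensor_vspace assoc_inner_bilinear] pure_tensor_closed assms)

end

context
  fixes V :: "('k::field, 'v, 'm) module_scheme" and W :: "('k, 'w, 'n) module_scheme"
  assumes V: "vspace V" and W: "vspace W"
begin

abbreviation (input) "swap_target \<equiv> tensor_space (tensor_space V W) (tensor_space V W)"
abbreviation (input) "swap_pure \<equiv> \<lambda>v v' w w'.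
  pure_tensor (tensor_space V W) (tensor_space V W) (pure_tensor V W v w) (pure_tensor V W v' w')"

lemma swap_inner_bilinear:
  assumes "v \<in> carrier V" "v' \<in> carrier V"
  shows "bilinear_map W W swap_target (swap_pure v v')"
  using bilinear_map_comp[OF pure_tensor_bilinear bilinear_mapD(1)[OF pure_tensor_bilinear assms(1)]
      bilinear_mapD(1)[OF pure_tensor_bilinear assms(2)] linear_maps_id(2)] .

lemma swap_middle_bilinear:
  assumes Y: "Y \<in> carrier (tensor_space W W)"
  shows "bilinear_map V V swap_target (\<lambda>v v'. tensor_lift swap_target (swap_pure v v') Y)"
proof -
  have bil: "bilinear_map V V swap_target (\<lambda>v v'. swap_pure v v' w w')"
    if "w \<in> carrier W" "w' \<in> carrier W" for w w'
    using bilinear_map_comp[OF pure_tensor_bilinear bilinear_mapD(2)[OF pure_tensor_bilinear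
      that(1)]
        bilinear_mapD(2)[OF pure_tensor_bilinear that(2)] linear_maps_id(2)] .
  show ?thesis
    unfolding bilinear_map_def
  proof (intro conjI ballI)
    fix v assume "v \<in> carrier V"
    then show "(\<lambda>v'. tensor_lift swap_target (swap_pure v v') Y) \<in> linear_maps V swap_target"
      by (intro tensor_lift_parameter[OF V W W tensor_vspace Y] swap_inner_bilinear)
        (use bilinear_mapD(1)[OF bil] in auto)
  next
    fix v' assume "v' \<in> carrier V"
    then show "(\<lambda>v. tensor_lift swap_target (swap_pure v v') Y) \<in> linear_maps V swap_target"
      by (intro tensor_lift_parameter[OF V W W tensor_vspace Y] swap_inner_bilinear)
        (use bilinear_mapD(2)[OF bil] in auto)
  qed
qed

lemma swap_outer_bilinear:
  "bilinear_map (tensor_space V V) (tensor_space W W) swap_target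
     (\<lambda>X Y. tensor_lift swap_target (\<lambda>v v'. tensor_lift swap_target (swap_pure v v') Y) X)"
  unfolding bilinear_map_def
proof (intro conjI ballI)
  fix X assume X: "X \<in> carrier (tensor_space V V)"
  show "(\<lambda>Y. tensor_lift swap_target (\<lambda>v v'. tensor_lift swap_target (swap_pure v v') Y) X)
      \<in> linear_maps (tensor_space W W) swap_target"
    by (intro tensor_lift_parameter[OF tensor_vspace V V tensor_vspace X] swap_middle_bilinear
        tensor_lift_linear[OF W W tensor_vspace] swap_inner_bilinear)
next
  fix Y assume "Y \<in> carrier (tensor_space W W)"
  then show "(\<lambda>X. tensor_lift swap_target (\<lambda>v v'. tensor_lift swap_target (swap_pure v v') Y) X)
      \<in> linear_maps (tensor_space V V) swap_target"
    by (intro tensor_lift_linear[OF V V tensor_vspace] swap_middle_bilinear)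
qed

lemma tensor_middle_swap_linear:
  "tensor_middle_swap V W \<in> linear_maps (tensor_space (tensor_space V V)
    (tensor_space W W)) swap_target"
  unfolding tensor_middle_swap_def Let_def
  by (rule tensor_lift_linear[OF tensor_vspace tensor_vspace tensor_vspace swap_outer_bilinear])

lemma tensor_middle_swap_pure:
  assumes "v \<in> carrier V" "v' \<in> carrier V" "w \<in> carrier W" "w' \<in> carrier W"
  shows "tensor_middle_swap V W (pure_tensor (tensor_space V V) (tensor_space W W)
     (pure_tensor V V v v') (pure_tensor W W w w')) = swap_pure v v' w w'"
  unfolding tensor_middle_swap_def Let_def
  by (simp add: tensor_lift_pure[OF tensor_vspace tensor_vspace tensor_vspace swap_outer_bilinear]
      tensor_lift_pure[OF V V tensor_vspace swap_middle_bilinear]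
      tensor_lift_pure[OF W W tensor_vspace swap_inner_bilinear] pure_tensor_closed assms)

end

section \<open>Separating families of functionals\<close>

definition tensor_functional where
  "tensor_functional e f = tensor_lift scalar_space (\<lambda>v w. e v * f w)"

lemma mult_bilinear: "bilinear_map (scalar_space :: ('k::field, 'k) module) scalar_space
  scalar_space (*)"
  by (auto simp: bilinear_map_def intro!: linear_mapsI simp: algebra_simps)

context
  fixes V :: "('k::field, 'v, 'm) module_scheme" and W :: "('k, 'w, 'n) module_scheme" and e f
  assumes V: "vspace V" and W: "vspace W"
    and e: "e \<in> linear_maps V scalar_space" and f: "f \<in> linear_maps W scalar_space"
begin

lemma functional_bilinear: "bilinear_map V W scalar_space (\<lambda>v w. e v * f w)"
  using bilinear_map_comp[OF mult_bilinear e f linear_maps_id(2)] .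

lemma tensor_functional_linear: "tensor_functional e f
  \<in> linear_maps (tensor_space V W) scalar_space"
  unfolding tensor_functional_def by (rule
    tensor_lift_linear[OF V W scalar_vspace functional_bilinear])

lemma tensor_functional_pure:
  "v \<in> carrier V \<Longrightarrow> w \<in> carrier W \<Longrightarrow> tensor_functional e f (pure_tensor V W v w) = e v * f w"
  unfolding tensor_functional_def by (rule
    tensor_lift_pure[OF V W scalar_vspace functional_bilinear])

end

definition separating where
  "separating V e \<longleftrightarrow> (\<forall>x. e x \<in> linear_maps V scalar_space) \<and>
     (\<forall>v\<in>carrier V. (\<forall>x. e x v = 0) \<longrightarrow> v = \<zero>\<^bsub>V\<^esub>)"

lemma separatingD: "separating V e \<Longrightarrow> e x \<in> linear_maps V scalar_space"
  by (simp add: separating_def)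

lemma separating_eqI:
  assumes "vspace V" "separating V e" "v \<in> carrier V" "w \<in> carrier V" "\<And>x. e x v = e x w"
  shows "v = w"
proof -
  interpret V: Module.module type_ring V by fact
  have w: "(-1) \<odot>\<^bsub>V\<^esub> w \<in> carrier V" using V.smult_closed[of "-1" w] assms(4) by simp
  have "e x (v \<oplus>\<^bsub>V\<^esub> (-1) \<odot>\<^bsub>V\<^esub> w) = 0" for x
    using linear_mapsD(2,3)[OF separatingD[OF assms(2), of x]] assms(3-5) w by simp
  then have 0: "v \<oplus>\<^bsub>V\<^esub> (-1) \<odot>\<^bsub>V\<^esub> w = \<zero>\<^bsub>V\<^esub>"
    using assms(2,3) w by (auto simp: separating_def)
  have "w \<oplus>\<^bsub>V\<^esub> (-1) \<odot>\<^bsub>V\<^esub> w = \<zero>\<^bsub>V\<^esub>"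
    using V.smult_l_distr[of 1 "-1" w] V.smult_one[of w] V.smult_l_null[of w] assms(4) by simp
  with 0 have "v \<oplus>\<^bsub>V\<^esub> (-1) \<odot>\<^bsub>V\<^esub> w = w \<oplus>\<^bsub>V\<^esub> (-1) \<odot>\<^bsub>V\<^esub> w" by simp
  then show ?thesis using V.add.right_cancel[OF w assms(3,4)] by simp
qed

text \<open>
  Let all \<open>e\<^sub>x \<otimes> f\<^sub>y\<close> vanish on \<open>t = v \<otimes> w + \<Sum> v\<^sub>i \<otimes> w\<^sub>i\<close>. If \<open>v \<noteq> 0\<close>, choose \<open>x\<close> with
  \<open>e\<^sub>x v \<noteq> 0\<close>. Applying \<open>e\<^sub>x\<close> to the first factor gives an element of \<open>W\<close> on which all \<open>f\<^sub>y\<close>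
  vanish, so that \<open>w\<close> is a linear combination of the \<open>w\<^sub>i\<close>. The first term is then absorbed
  into the others, and induction on the number of terms shows \<open>t = 0\<close>.
\<close>

lemma separating_tensor:
  assumes V: "vspace V" and W: "vspace W"
    and e: "separating V e" and f: "separating W f"
  shows "separating (tensor_space V W) (\<lambda>(x, y). tensor_functional (e x) (f y))"
proof -
  interpret V: Module.module type_ring V by (rule V)
  interpret W: Module.module type_ring W by (rule W)
  interpret T: Module.module type_ring "tensor_space V W" by (rule tensor_vspace)
  let ?T = "tensor_space V W"
  let ?tsum = "\<lambda>ps. foldr (\<lambda>(v, w) t. pure_tensor V W v w \<oplus>\<^bsub>?T\<^esub> t) ps \<zero>\<^bsub>?T\<^esub>"
  let ?wsum = "\<lambda>c ps. foldr (\<lambda>(v, w) s. c v \<odot>\<^bsub>W\<^esub> w \<oplus>\<^bsub>W\<^esub> s) ps \<zero>\<^bsub>W\<^esub>"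
  let ?ok = "\<lambda>ps. set ps \<subseteq> carrier V \<times> carrier W"
  have Vs: "c \<odot>\<^bsub>V\<^esub> v \<in> carrier V" if "v \<in> carrier V" for c v using V.smult_closed[of c v] that by simp
  have Ws: "c \<odot>\<^bsub>W\<^esub> w \<in> carrier W" if "w \<in> carrier W" for c w using W.smult_closed[of c w] that by simp
  note T_mult = linear_mapsD(2,3)[OF bilinear_mapD(1)[OF pure_tensor_bilinear[of V W]]]
    linear_mapsD(2,3)[OF bilinear_mapD(2)[OF pure_tensor_bilinear[of V W]]]
  have ef: "tensor_functional (e x) (f y) \<in> linear_maps ?T scalar_space" for x y
    by (rule tensor_functional_linear[OF V W separatingD[OF e] separatingD[OF f]])
  have ef_pure: "tensor_functional (e x) (f y) (pure_tensor V W v w) = e x v * f y w"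
    if "v \<in> carrier V" "w \<in> carrier W" for x y v w
    by (rule tensor_functional_pure[OF V W separatingD[OF e] separatingD[OF f] that])
  have tsum_closed: "?tsum ps \<in> carrier ?T" if "?ok ps" for ps
    using that by (induction ps) (auto simp: pure_tensor_closed)
  have wsum_closed: "?wsum c ps \<in> carrier W" if "?ok ps" for c ps
    using that by (induction ps) (auto simp: Ws)
  have tsum_append: "?tsum (ps @ qs) = ?tsum ps \<oplus>\<^bsub>?T\<^esub> ?tsum qs" if "?ok ps" "?ok qs" for ps qs
    using that by (induction ps) (auto simp: pure_tensor_closed tsum_closed T.a_assoc)
  have repr: "\<exists>ps. ?ok ps \<and> t = ?tsum ps" if "t \<in> carrier ?T" for t
    using that V W
  proof (induction rule: tensor_induct)
    case (pure v w)
    then show ?case by (intro exI[of _ "[(v, w)]"]) (simp add: pure_tensor_closed)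
  next
    case (add s t)
    then obtain ps qs where "?ok ps" "s = ?tsum ps" "?ok qs" "t = ?tsum qs" by blast
    then show ?case using tsum_append by (intro exI[of _ "ps @ qs"]) simp
  qed
  have ef_tsum: "tensor_functional (e x) (f y) (?tsum ps) = (\<Sum>(v, w)\<leftarrow>ps. e x v * f y w)"
    if "?ok ps" for x y ps
    using that
    by (induction ps) (auto simp: linear_maps_zero[OF tensor_vspace scalar_vspace ef]
        linear_mapsD(2)[OF ef] tsum_closed pure_tensor_closed ef_pure)
  have f_wsum: "f y (?wsum c ps) = (\<Sum>(v, w)\<leftarrow>ps. c v * f y w)" if "?ok ps" for y c ps
    using that
    by (induction ps) (auto simp: linear_maps_zero[OF W scalar_vspace separatingD[OF f]]
        linear_mapsD(2,3)[OF separatingD[OF f]] wsum_closed Ws)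
  have absorb: "pure_tensor V W v (?wsum c ps) \<oplus>\<^bsub>?T\<^esub> ?tsum ps =
      ?tsum (map (\<lambda>(v', w'). (v' \<oplus>\<^bsub>V\<^esub> c v' \<odot>\<^bsub>V\<^esub> v, w')) ps)"
    if "?ok ps" "v \<in> carrier V" for v c ps
    using that
  proof (induction ps)
    case Nil
    then show ?case
      using linear_maps_zero[OF W tensor_vspace bilinear_mapD(1)[OF pure_tensor_bilinear Nil(2)]]
        by simp
  next
    case (Cons p ps)
    obtain v' w' where p: "p = (v', w')" "v' \<in> carrier V" "w' \<in> carrier W" using Cons by auto
    have ok: "?ok ps" using Cons by simp
    have "pure_tensor V W v (?wsum c (p # ps)) \<oplus>\<^bsub>?T\<^esub> ?tsum (p # ps) =
        (pure_tensor V W v' w' \<oplus>\<^bsub>?T\<^esub> c v' \<odot>\<^bsub>?T\<^esub> pure_tensor V W v w') \<oplus>\<^bsub>?T\<^esub>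
        (pure_tensor V W v (?wsum c ps) \<oplus>\<^bsub>?T\<^esub> ?tsum ps)"
      using T.smult_closed[of "c v'" "pure_tensor V W v w'"] p Cons.prems ok
      by (simp add: T_mult Ws wsum_closed tsum_closed pure_tensor_closed T.a_ac)
    also have "pure_tensor V W v' w' \<oplus>\<^bsub>?T\<^esub> c v' \<odot>\<^bsub>?T\<^esub> pure_tensor V W v w' =
        pure_tensor V W (v' \<oplus>\<^bsub>V\<^esub> c v' \<odot>\<^bsub>V\<^esub> v) w'"
      using p Cons.prems by (simp add: T_mult Vs)
    finally show ?case using Cons.IH[OF ok Cons.prems(2)] p by simp
  qed
  have main: "?tsum ps = \<zero>\<^bsub>?T\<^esub>"
    if "?ok ps" "\<And>x y. tensor_functional (e x) (f y) (?tsum ps) = 0" for ps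
    using that
  proof (induction "length ps" arbitrary: ps)
    case (Suc n)
    then obtain v w qs where ps: "ps = (v, w) # qs" "v \<in> carrier V" "w \<in> carrier W" "?ok qs"
      by (cases ps) auto
    show ?case
    proof (cases "v = \<zero>\<^bsub>V\<^esub>")
      case True
      then have "pure_tensor V W v w = \<zero>\<^bsub>?T\<^esub>"
        using linear_maps_zero[OF V tensor_vspace bilinear_mapD(2)[OF pure_tensor_bilinear ps(3)]]
          by simp
      then have "?tsum ps = ?tsum qs" using ps tsum_closed by simp
      then show ?thesis using Suc(1)[of qs] Suc(2-) ps by simp
    next
      case False
      then obtain x where x: "e x v \<noteq> 0" using e ps(2) by (auto simp: separating_def)
      \<comment> \<open>the coefficients that express \<open>w\<close> through the other second factors\<close>
      define c where "c v' = - e x v' / e x v" for v'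
      have "w = ?wsum c qs"
      proof (rule separating_eqI[OF W f ps(3) wsum_closed[OF ps(4)]])
        fix y
        have "e x v * f y w + (\<Sum>(v', w')\<leftarrow>qs. e x v' * f y w') = 0"
          using Suc(4)[of x y] ef_tsum[OF Suc(3)] ps(1) by simp
        moreover have "(\<Sum>(v', w')\<leftarrow>qs. c v' * f y w') = - (\<Sum>(v', w')\<leftarrow>qs. e x v' * f y w') / e x v"
          unfolding c_def by (induction qs) (auto simp: diff_divide_distrib add_divide_distrib)
        ultimately show "f y w = f y (?wsum c qs)"
          using x f_wsum[OF ps(4)] by (simp add: field_simps add_eq_0_iff)
      qed
      then have eq: "?tsum ps = ?tsum (map (\<lambda>(v', w'). (v' \<oplus>\<^bsub>V\<^esub> c v' \<odot>\<^bsub>V\<^esub> v, w')) qs)"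
        using absorb[OF ps(4,2), of c] ps(1) by simp
      show ?thesis
        unfolding eq
        by (rule Suc(1)) (use Suc(2,4) ps eq in \<open>auto simp: Vs\<close>)
    qed
  qed simp
  show ?thesis
    unfolding separating_def
  proof (intro conjI allI ballI impI)
    fix t assume "t \<in> carrier ?T" "\<forall>x. (case x of (x, y) \<Rightarrow> tensor_functional (e x) (f y)) t = 0"
    then show "t = \<zero>\<^bsub>?T\<^esub>" using repr[of t] main by auto
  qed (use ef in auto)
qed

section \<open>Coalgebras coordinatized by a monoid\<close>

text \<open>
  The coalgebras below are record extensions of the spaces they are built on; the following
  congruences transfer statements between the two.
\<close>

lemma tensor_space_cong:
  assumes "carrier V = carrier V'" "add V = add V'" "smult V = smult V'"
    and "carrier W = carrier W'" "add W = add W'" "smult W = smult W'"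
  shows "tensor_space V W = tensor_space V' W'" "pure_tensor V W = pure_tensor V' W'"
proof -
  have "tensor_null V W = tensor_null V' W'"
    by (simp add: tensor_null_def tensor_relators_def assms)
  then show "tensor_space V W = tensor_space V' W'" "pure_tensor V W = pure_tensor V' W'"
    by (simp_all add: tensor_space_def tensor_class_def[abs_def] pure_tensor_def[abs_def] assms)
qed

lemma vspace_cong:
  fixes V :: "('k::field, 'v, 'm) module_scheme" and V' :: "('k, 'v, 'n) module_scheme"
  assumes V: "vspace V"
    and "carrier V' = carrier V" "zero V' = zero V" "add V' = add V" "smult V' = smult V"
  shows "vspace V'"
proof -
  interpret Module.module type_ring V by (rule V)
  have "c \<odot>\<^bsub>V\<^esub> x \<in> carrier V" "(-1) \<odot>\<^bsub>V\<^esub> x \<oplus>\<^bsub>V\<^esub> x = \<zero>\<^bsub>V\<^esub>" if "x \<in> carrier V" for c x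
    using that smult_closed[of c x] smult_l_distr[of "-1" 1 x] smult_one[of x] smult_l_null[of x]
    by simp_all
  then show ?thesis
    using smult_l_distr smult_r_distr smult_assoc1 smult_one
    by (intro vspaceI) (simp_all add: assms(2-5) a_ac)
qed

lemma scaled_linear_maps:
  assumes "g \<in> linear_maps V scalar_space"
  shows "(\<lambda>t. c * g t) \<in> linear_maps V scalar_space" "(\<lambda>t. g t * c) \<in> linear_maps V scalar_space"
  using assms by (auto simp: linear_maps_def algebra_simps)

lemma separating_cong:
  assumes "carrier V = carrier V'" "zero V = zero V'" "add V = add V'" "smult V = smult V'"
  shows "separating V e \<longleftrightarrow> separating V' e"
  by (simp add: separating_def linear_maps_def assms)

lemma extend_simps [simp]:
  "carrier (module.extend V X) = carrier V" "zero (module.extend V X) = zero V"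
  "add (module.extend V X) = add V" "smult (module.extend V X) = smult V"
  "comult (module.extend V (coalg.fields \<delta> \<epsilon>)) = \<delta>"
    "counit (module.extend V (coalg.fields \<delta> \<epsilon>)) = \<epsilon>"
  by (simp_all add: module.defs coalg.defs)

lemma tensor_space_extend [simp]:
  "tensor_space (module.extend V X) (module.extend V Y) = tensor_space V V"
  by (rule tensor_space_cong) simp_all

text \<open>
  Linearity of the comultiplication and the coalgebra laws follow from these data because the
  coordinates separate points.
\<close>

locale monoid_coordinates =
  fixes C :: "('k::field, 'c, 'm) coalg_scheme" and e :: "'x \<Rightarrow> 'c \<Rightarrow> 'k"
    and m :: "'x \<Rightarrow> 'x \<Rightarrow> 'x" and u :: 'x
  assumes vspace: "vspace C" and separating: "separating C e"
    and comult_closed: "x \<in> carrier C \<Longrightarrow> comult C x \<in> carrier (tensor_space C C)"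
    and comult_coordinate:
      "x \<in> carrier C \<Longrightarrow> tensor_functional (e a) (e b) (comult C x) = e (m a b) x"
    and counit_coordinate: "x \<in> carrier C \<Longrightarrow> counit C x = e u x"
    and assoc: "m (m a b) c = m a (m b c)" and left_unit: "m u a = a" and right_unit: "m a u = a"
begin

lemma e_linear: "e a \<in> linear_maps C scalar_space"
  by (rule separatingD[OF separating])

lemma separating2: "separating (tensor_space C C) (\<lambda>(a, b). tensor_functional (e a) (e b))"
  by (rule separating_tensor[OF vspace vspace separating separating])

lemma ee_linear: "tensor_functional (e a) (e b) \<in> linear_maps (tensor_space C C) scalar_space"
  by (rule tensor_functional_linear[OF vspace vspace e_linear e_linear])

lemma tensor2_eqI:
  assumes "s \<in> carrier (tensor_space C C)" "t \<in> carrier (tensor_space C C)"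
    and "\<And>a b. tensor_functional (e a) (e b) s = tensor_functional (e a) (e b) t"
  shows "s = t"
  by (rule separating_eqI[OF tensor_vspace separating2 assms(1,2)]) (use assms(3) in auto)

lemma comult_linear: "comult C \<in> linear_maps C (tensor_space C C)"
proof -
  interpret Module.module type_ring C by (rule vspace)
  interpret T: Module.module type_ring "tensor_space C C" by (rule tensor_vspace)
  show ?thesis
  proof (rule linear_mapsI)
    fix x y c assume x: "x \<in> carrier C"
    show "comult C x \<in> carrier (tensor_space C C)" by (rule comult_closed[OF x])
    have "c \<odot>\<^bsub>C\<^esub> x \<in> carrier C" using smult_closed[of c x] x by simp
    then show "comult C (c \<odot>\<^bsub>C\<^esub> x) = c \<odot>\<^bsub>tensor_space C C\<^esub> comult C x"
      using x T.smult_closed[of c "comult C x"]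
      by (intro tensor2_eqI) (simp_all add: comult_closed comult_coordinate
          linear_mapsD(3)[OF ee_linear] linear_mapsD(3)[OF e_linear])
    assume y: "y \<in> carrier C"
    then show "comult C (x \<oplus>\<^bsub>C\<^esub> y) = comult C x \<oplus>\<^bsub>tensor_space C C\<^esub> comult C y"
      using x by (intro tensor2_eqI) (simp_all add: comult_closed comult_coordinate
          linear_mapsD(2)[OF ee_linear] linear_mapsD(2)[OF e_linear])
  qed
qed

lemma counit_linear: "counit C \<in> linear_maps C scalar_space"
proof -
  interpret Module.module type_ring C by (rule vspace)
  show ?thesis
    using e_linear[of u] smult_closed
    by (intro linear_mapsI) (simp_all add: counit_coordinate linear_mapsD)
qed

text \<open>
  Both sides of coassociativity have the coordinates \<open>e\<^sub>a\<^sub>b\<^sub>c x\<close>, bracketed in the two possible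
  ways, and both counit laws compare \<open>x\<close> with an element whose coordinates are \<open>e\<^sub>1\<^sub>b x\<close> or \<open>e\<^sub>a\<^sub>1 x\<close>.
\<close>

lemma coalgebra: "coalgebra C"
proof -
  let ?CC = "tensor_space C C"
  let ?T = "tensor_space C ?CC"
  interpret C: Module.module type_ring C by (rule vspace)
  note V = vspace
  show ?thesis
  proof (intro coalgebra.intro coalgebra_axioms.intro)
    fix x assume x: "x \<in> carrier C"
    define L where "L = (\<lambda>t. tensor_assoc C C C (tensor_map ?CC C (comult C) id t))"
    define R where "R = tensor_map C ?CC id (comult C)"
    have L: "L \<in> linear_maps ?CC ?T"
      unfolding L_def
      by (rule linear_maps_comp[OF tensor_map_linear[OF V V comult_linear linear_maps_id(1)]
            tensor_assoc_linear[OF V V V]])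
    have R: "R \<in> linear_maps ?CC ?T"
      unfolding R_def by (rule tensor_map_linear[OF V V linear_maps_id(1) comult_linear])
    have sep: "separating ?T (\<lambda>(a, b). tensor_functional (e a)
      ((\<lambda>(b, c). tensor_functional (e b) (e c)) b))"
      by (rule separating_tensor[OF V tensor_vspace separating separating2])
    have E: "tensor_functional (e a) (tensor_functional (e b) (e c))
      \<in> linear_maps ?T scalar_space" for a b c
      by (rule tensor_functional_linear[OF V tensor_vspace e_linear ee_linear])
    have E_pure: "tensor_functional (e a) (tensor_functional (e b) (e c)) (pure_tensor C ?CC x y) =
        e a x * tensor_functional (e b) (e c) y" if "x \<in> carrier C" "y \<in> carrier ?CC" for a b c x y
      by (rule tensor_functional_pure[OF V tensor_vspace e_linear ee_linear that])
    have EL: "tensor_functional (e a) (tensor_functional (e b) (e c)) (L t) =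
      tensor_functional (e (m a b)) (e c) t"
      if t: "t \<in> carrier ?CC" for a b c t
    proof (rule linear_maps_tensor_eqI[OF V V linear_maps_comp[OF L E] ee_linear t])
      fix v w assume v: "v \<in> carrier C" and w: "w \<in> carrier C"
      have "tensor_functional (e a) (tensor_functional (e b) (e c))
        (tensor_assoc C C C (pure_tensor ?CC C Y w)) =
          e c w * tensor_functional (e a) (e b) Y" if Y: "Y \<in> carrier ?CC" for Y
      proof (rule linear_maps_tensor_eqI[OF V V _ _ Y])
        show "(\<lambda>Y. e c w * tensor_functional (e a) (e b) Y) \<in> linear_maps ?CC scalar_space"
          by (rule linear_maps_comp[OF ee_linear]) (auto intro!: linear_mapsI simp: algebra_simps)
        show "(\<lambda>Y. tensor_functional (e a) (tensor_functional (e b) (e c))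
          (tensor_assoc C C C (pure_tensor ?CC C Y w)))
            \<in> linear_maps ?CC scalar_space"
          by (rule linear_maps_comp[OF linear_maps_comp[OF bilinear_mapD(2)[OF
            pure_tensor_bilinear w]
                  tensor_assoc_linear[OF V V V]] E])
      qed (simp add: tensor_assoc_pure[OF V V V] w E_pure pure_tensor_closed
            tensor_functional_pure[OF V V e_linear e_linear])
      then show "tensor_functional (e a) (tensor_functional (e b) (e c)) (L (pure_tensor C C v w)) =
          tensor_functional (e (m a b)) (e c) (pure_tensor C C v w)"
        using v w by (simp add: L_def tensor_map_pure[OF V V comult_linear linear_maps_id(1)]
            comult_closed comult_coordinate tensor_functional_pure[OF V V e_linear e_linear])
    qed
    have ER: "tensor_functional (e a) (tensor_functional (e b) (e c)) (R t) =
      tensor_functional (e a) (e (m b c)) t"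
      if t: "t \<in> carrier ?CC" for a b c t
      by (rule linear_maps_tensor_eqI[OF V V linear_maps_comp[OF R E] ee_linear t])
        (simp add: R_def tensor_map_pure[OF V V linear_maps_id(1) comult_linear] comult_closed
          comult_coordinate E_pure tensor_functional_pure[OF V V e_linear e_linear])
    have "L (comult C x) = R (comult C x)"
      by (rule separating_eqI[OF tensor_vspace sep])
        (auto simp: linear_mapsD(1)[OF L] linear_mapsD(1)[OF R] comult_closed x EL ER
          comult_coordinate assoc)
    then show "tensor_assoc C C C (tensor_map ?CC C (comult C) id (comult C x)) =
        tensor_map C ?CC id (comult C) (comult C x)"
      unfolding L_def R_def .
    have smult_bil: "bilinear_map scalar_space C C (\<lambda>c x. c \<odot>\<^bsub>C\<^esub> x)"
      using C.smult_closed C.smult_l_distr C.smult_r_distr C.smult_assoc1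
      by (auto simp: bilinear_map_def intro!: linear_mapsI simp flip: C.smult_assoc1 simp:
        mult.commute)
    have left: "bilinear_map C C C (\<lambda>a b. counit C a \<odot>\<^bsub>C\<^esub> b)"
      using bilinear_map_comp[OF smult_bil counit_linear linear_maps_id(2) linear_maps_id(2)] .
    then have right: "bilinear_map C C C (\<lambda>a b. counit C b \<odot>\<^bsub>C\<^esub> a)"
      by (simp add: bilinear_map_def)
    note lift_left = tensor_lift_linear[OF V V V left]
    note lift_right = tensor_lift_linear[OF V V V right]
    show "tensor_lift C (\<lambda>a b. counit C a \<odot>\<^bsub>C\<^esub> b) (comult C x) = x"
    proof (rule separating_eqI[OF V separating linear_mapsD(1)[OF lift_left comult_closed[OF x]] x])
      fix b
      have "e b (tensor_lift C (\<lambda>a b. counit C a \<odot>\<^bsub>C\<^esub> b) (comult C x)) =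
        tensor_functional (e u) (e b) (comult C x)"
        by (rule linear_maps_tensor_eqI[OF V V linear_maps_comp[OF lift_left e_linear] ee_linear
          comult_closed[OF x]])
          (simp add: tensor_lift_pure[OF V V V left]
            tensor_functional_pure[OF V V e_linear e_linear]
            linear_mapsD(3)[OF e_linear] counit_coordinate)
      then show "e b (tensor_lift C (\<lambda>a b. counit C a \<odot>\<^bsub>C\<^esub> b) (comult C x)) = e b x"
        by (simp add: comult_coordinate x left_unit)
    qed
    show "tensor_lift C (\<lambda>a b. counit C b \<odot>\<^bsub>C\<^esub> a) (comult C x) = x"
    proof (rule separating_eqI[OF V separating
      linear_mapsD(1)[OF lift_right comult_closed[OF x]] x])
      fix a
      have "e a (tensor_lift C (\<lambda>a b. counit C b \<odot>\<^bsub>C\<^esub> a) (comult C x)) =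
        tensor_functional (e a) (e u) (comult C x)"
        by (rule linear_maps_tensor_eqI[OF V V linear_maps_comp[OF lift_right e_linear] ee_linear
          comult_closed[OF x]])
          (simp add: tensor_lift_pure[OF V V V right]
            tensor_functional_pure[OF V V e_linear e_linear]
            linear_mapsD(3)[OF e_linear] counit_coordinate)
      then show "e a (tensor_lift C (\<lambda>a b. counit C b \<odot>\<^bsub>C\<^esub> a) (comult C x)) = e a x"
        by (simp add: comult_coordinate x right_unit)
    qed
  qed (fact vspace comult_linear counit_linear)+
qed

end

text \<open>
  The contravariance is deliberate: \<open>h\<close> runs from the index monoid of the target to that of the
  source, as algebra maps do under duality.
\<close>

lemma coalgebra_hom_coordinates:
  assumes C: "monoid_coordinates C e m u" and D: "monoid_coordinates D f n w"
    and h: "\<And>a b. h (n a b) = m (h a) (h b)" "h w = u"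
    and \<phi>: "\<And>x. x \<in> carrier C \<Longrightarrow> \<phi> x \<in> carrier D"
      "\<And>x y. x \<in> carrier C \<Longrightarrow> f y (\<phi> x) = e (h y) x"
  shows "\<phi> \<in> coalgebra_hom C D"
proof -
  interpret C: monoid_coordinates C e m u by (rule C)
  interpret D: monoid_coordinates D f n w by (rule D)
  interpret VC: Module.module type_ring C by (rule C.vspace)
  interpret VD: Module.module type_ring D by (rule D.vspace)
  have smult: "c \<odot>\<^bsub>C\<^esub> x \<in> carrier C" "c \<odot>\<^bsub>D\<^esub> y \<in> carrier D" if "x \<in> carrier C" "y \<in> carrier D" for x y c
    using VC.smult_closed[of c x] VD.smult_closed[of c y] that by auto
  have linear: "\<phi> \<in> linear_maps C D"
  proof (rule linear_mapsI)
    fix x y c assume x: "x \<in> carrier C"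
    show "\<phi> x \<in> carrier D" by (rule \<phi>(1)[OF x])
    show "\<phi> (c \<odot>\<^bsub>C\<^esub> x) = c \<odot>\<^bsub>D\<^esub> \<phi> x"
      by (rule separating_eqI[OF D.vspace D.separating])
        (use x \<phi>(1)[OF x] in \<open>simp_all add: \<phi> smult linear_mapsD(3)[OF C.e_linear]
          linear_mapsD(3)[OF D.e_linear]\<close>)
    assume y: "y \<in> carrier C"
    show "\<phi> (x \<oplus>\<^bsub>C\<^esub> y) = \<phi> x \<oplus>\<^bsub>D\<^esub> \<phi> y"
      by (rule separating_eqI[OF D.vspace D.separating])
        (use x y \<phi>(1)[OF x] in \<open>simp_all add: \<phi> linear_mapsD(2)[OF C.e_linear]
          linear_mapsD(2)[OF D.e_linear]\<close>)
  qed
  note map_linear = tensor_map_linear[OF C.vspace C.vspace linear linear]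
  have "tensor_map D D \<phi> \<phi> (comult C x) = comult D (\<phi> x)" if x: "x \<in> carrier C" for x
  proof (rule D.tensor2_eqI)
    show "tensor_map D D \<phi> \<phi> (comult C x) \<in> carrier (tensor_space D D)"
      by (rule linear_mapsD(1)[OF map_linear C.comult_closed[OF x]])
    show "comult D (\<phi> x) \<in> carrier (tensor_space D D)"
      by (rule D.comult_closed[OF \<phi>(1)[OF x]])
    fix a b
    have "tensor_functional (f a) (f b) (tensor_map D D \<phi> \<phi> (comult C x)) =
        tensor_functional (e (h a)) (e (h b)) (comult C x)"
      by (rule linear_maps_tensor_eqI[OF C.vspace C.vspace
        linear_maps_comp[OF map_linear D.ee_linear]
            C.ee_linear C.comult_closed[OF x]])
        (simp add: tensor_map_pure[OF C.vspace C.vspace linear linear] \<phi>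
          tensor_functional_pure[OF C.vspace C.vspace C.e_linear C.e_linear]
          tensor_functional_pure[OF D.vspace D.vspace D.e_linear D.e_linear])
    then show "tensor_functional (f a) (f b) (tensor_map D D \<phi> \<phi> (comult C x)) =
        tensor_functional (f a) (f b) (comult D (\<phi> x))"
      using x by (simp add: C.comult_coordinate D.comult_coordinate \<phi> h)
  qed
  with linear show ?thesis
    by (simp add: coalgebra_hom_def C.counit_coordinate D.counit_coordinate \<phi> h)
qed

lemma monoid_coordinates_tensor:
  assumes C: "monoid_coordinates C e m u" and D: "monoid_coordinates D f n w"
  shows "monoid_coordinates (tensor_coalgebra C D) (\<lambda>(x, y). tensor_functional (e x) (f y))
     (\<lambda>(x, y) (x', y'). (m x x', n y y')) (u, w)"
proof -
  interpret C: monoid_coordinates C e m u by (rule C)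
  interpret D: monoid_coordinates D f n w by (rule D)
  let ?P = "tensor_space C D"
  let ?PP = "tensor_space ?P ?P"
  let ?CC = "tensor_space C C"
  let ?DD = "tensor_space D D"
  let ?e = "\<lambda>x y. tensor_functional (e x) (f y)"
  define \<Delta> where "\<Delta> = (\<lambda>t. tensor_middle_swap C D (tensor_map ?CC ?DD (comult C) (comult D) t))"
  note VC = C.vspace and VD = D.vspace
  note ef_linear = tensor_functional_linear[OF VC VD C.e_linear D.e_linear]
  have ef_pure: "?e x y (pure_tensor C D v w) = e x v * f y w"
    if "v \<in> carrier C" "w \<in> carrier D" for x y v w
    by (rule tensor_functional_pure[OF VC VD C.e_linear D.e_linear that])
  have E: "tensor_functional (?e x y) (?e x' y') \<in> linear_maps ?PP scalar_space" for x y x' y'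
    by (rule tensor_functional_linear[OF tensor_vspace tensor_vspace ef_linear ef_linear])
  note swap = tensor_middle_swap_linear[OF VC VD]
  note \<Delta>_map = tensor_map_linear[OF VC VD C.comult_linear D.comult_linear]
  have \<Delta>: "\<Delta> \<in> linear_maps ?P ?PP"
    unfolding \<Delta>_def by (rule linear_maps_comp[OF \<Delta>_map swap])
  \<comment> \<open>the middle swap exchanges the two inner coordinates; it suffices to see this on pure tensors
    in each argument\<close>
  have E_swap: "tensor_functional (?e x y) (?e x' y')
    (tensor_middle_swap C D (pure_tensor ?CC ?DD X Y)) =
      tensor_functional (e x) (e x') X * tensor_functional (f y) (f y') Y"
    if X: "X \<in> carrier ?CC" and Y: "Y \<in> carrier ?DD" for x y x' y' X Y
  proof (rule linear_maps_tensor_eqI[OF VC VC _ _ X])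
    show "(\<lambda>X. tensor_functional (?e x y) (?e x' y')
      (tensor_middle_swap C D (pure_tensor ?CC ?DD X Y)))
        \<in> linear_maps ?CC scalar_space"
      by (rule linear_maps_comp[OF linear_maps_comp[OF bilinear_mapD(2)[OF pure_tensor_bilinear Y]
        swap] E])
    show "(\<lambda>X. tensor_functional (e x) (e x') X * tensor_functional (f y) (f y') Y)
        \<in> linear_maps ?CC scalar_space"
      by (rule scaled_linear_maps(2)[OF C.ee_linear])
    fix c c' assume c: "c \<in> carrier C" "c' \<in> carrier C"
    note cc = pure_tensor_closed[OF c]
    show "tensor_functional (?e x y) (?e x' y')
        (tensor_middle_swap C D (pure_tensor ?CC ?DD (pure_tensor C C c c') Y)) =
      tensor_functional (e x) (e x') (pure_tensor C C c c') * tensor_functional (f y) (f y') Y"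
    proof (rule linear_maps_tensor_eqI[OF VD VD _ _ Y])
      show "(\<lambda>Y. tensor_functional (?e x y) (?e x' y')
          (tensor_middle_swap C D (pure_tensor ?CC ?DD (pure_tensor C C c c') Y)))
            \<in> linear_maps ?DD scalar_space"
        by (rule linear_maps_comp[OF linear_maps_comp[OF bilinear_mapD(1)[OF pure_tensor_bilinear
          cc] swap] E])
      show "(\<lambda>Y. tensor_functional (e x) (e x') (pure_tensor C C c c') *
        tensor_functional (f y) (f y') Y)
          \<in> linear_maps ?DD scalar_space"
        by (rule scaled_linear_maps(1)[OF D.ee_linear])
      fix d d' assume d: "d \<in> carrier D" "d' \<in> carrier D"
      show "tensor_functional (?e x y) (?e x' y')
          (tensor_middle_swap C D (pure_tensor ?CC ?DD (pure_tensor C C c c')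
            (pure_tensor D D d d'))) =
        tensor_functional (e x) (e x') (pure_tensor C C c c') * tensor_functional (f y) (f y')
          (pure_tensor D D d d')"
        using c d
        by (simp add: tensor_middle_swap_pure[OF VC VD] pure_tensor_closed ef_pure
            tensor_functional_pure[OF tensor_vspace tensor_vspace ef_linear ef_linear]
            tensor_functional_pure[OF VC VC C.e_linear C.e_linear]
            tensor_functional_pure[OF VD VD D.e_linear D.e_linear])
    qed
  qed
  have E_\<Delta>: "tensor_functional (?e x y) (?e x' y') (\<Delta> t) = ?e (m x x') (n y y') t"
    if t: "t \<in> carrier ?P" for x y x' y' t
    by (rule linear_maps_tensor_eqI[OF VC VD linear_maps_comp[OF \<Delta> E] ef_linear t])
      (simp add: \<Delta>_def tensor_map_pure[OF VC VD C.comult_linear D.comult_linear] E_swap ef_pure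
        C.comult_closed D.comult_closed C.comult_coordinate D.comult_coordinate)
  have counit: "tensor_functional (counit C) (counit D) t = ?e u w t" if t: "t \<in> carrier ?P" for t
    by (rule linear_maps_tensor_eqI[OF VC VD
          tensor_functional_linear[OF VC VD C.counit_linear D.counit_linear] ef_linear t])
      (simp add: ef_pure C.counit_coordinate D.counit_coordinate
        tensor_functional_pure[OF VC VD C.counit_linear D.counit_linear])
  show ?thesis
  proof (rule monoid_coordinates.intro)
    show "vspace (tensor_coalgebra C D)"
      by (rule vspace_cong[OF tensor_vspace[of C D]]) (simp_all add: tensor_coalgebra_def)
    show "separating (tensor_coalgebra C D) (\<lambda>(x, y). ?e x y)"
      using separating_tensor[OF VC VD C.separating D.separating]
      by (subst separating_cong[where V' = ?P]) (simp_all add: tensor_coalgebra_def)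
  next
    fix t assume "t \<in> carrier (tensor_coalgebra C D)"
    then have t: "t \<in> carrier ?P" by (simp add: tensor_coalgebra_def)
    show "comult (tensor_coalgebra C D) t \<in> carrier (tensor_space (tensor_coalgebra C D)
      (tensor_coalgebra C D))"
      using linear_mapsD(1)[OF \<Delta> t] by (simp add: tensor_coalgebra_def \<Delta>_def)
    show "tensor_functional ((\<lambda>(x, y). ?e x y) a) ((\<lambda>(x, y). ?e x y) b)
      (comult (tensor_coalgebra C D) t) =
        (\<lambda>(x, y). ?e x y) ((\<lambda>(x, y) (x', y'). (m x x', n y y')) a b) t" for a b
      using E_\<Delta>[OF t] by (simp add: tensor_coalgebra_def \<Delta>_def split: prod.split)
    show "counit (tensor_coalgebra C D) t = (\<lambda>(x, y). ?e x y) (u, w) t"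
      using counit[OF t] by (simp add: tensor_coalgebra_def tensor_functional_def)
  qed (auto simp: C.assoc D.assoc C.left_unit D.left_unit C.right_unit D.right_unit
    split: prod.split)
qed

section \<open>Coordinates of functionals and of divided powers\<close>

lemma functional_space_simps [simp]:
  "carrier (functional_space F) = F" "zero (functional_space F) = (\<lambda>_. 0)"
  "add (functional_space F) = (\<lambda>f g a. f a + g a)" "smult (functional_space F) = (\<lambda>c f a. c * f a)"
  by (simp_all add: functional_space_def)

text \<open>
  Closure of \<open>F\<close> under splitting \<open>f (a * b)\<close> provides the tensor in the definite description of
  the comultiplication, and the separation by evaluations makes it unique.
\<close>

lemma monoid_coordinates_functional:
  fixes F :: "('a::ring_1 \<Rightarrow> 'k::field) set"
  assumes F: "(\<lambda>_. 0) \<in> F" "\<And>f g. f \<in> F \<Longrightarrow> g \<in> F \<Longrightarrow> (\<lambda>a. f a + g a) \<in> F"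
      "\<And>c f. f \<in> F \<Longrightarrow> (\<lambda>a. c * f a) \<in> F"
    and split: "\<And>f. f \<in> F \<Longrightarrow> \<exists>(I :: 'i set) g h. finite I \<and> (\<forall>i\<in>I. g i \<in> F \<and> h i \<in> F) \<and>
      (\<forall>a b. f (a * b) = (\<Sum>i\<in>I. g i a * h i b))"
  shows "monoid_coordinates (functional_coalgebra F) (\<lambda>a f. f a) (*) 1"
proof -
  let ?V = "functional_space F"
  let ?T = "tensor_space ?V ?V"
  have V: "vspace ?V" by (rule vspaceI) (use F in \<open>auto simp: algebra_simps\<close>)
  have sep: "separating ?V (\<lambda>a f. f a)"
    by (auto simp: separating_def intro!: linear_mapsI)
  have ev: "(\<lambda>f. f a) \<in> linear_maps ?V scalar_space" for a by (rule separatingD[OF sep])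
  let ?e = "\<lambda>a b. tensor_functional (\<lambda>f. f a) (\<lambda>f. f b)"
  have comult: "\<exists>!t. t \<in> carrier ?T \<and> (\<forall>a b. ?e a b t = f (a * b))" if f: "f \<in> F" for f
  proof (rule ex_ex1I)
    from split[OF f] obtain I :: "'i set" and g h where I: "finite I" "\<forall>i\<in>I. g i \<in> F \<and> h i \<in> F"
      "\<forall>a b. f (a * b) = (\<Sum>i\<in>I. g i a * h i b)" by blast
    interpret T: Module.module type_ring ?T by (rule tensor_vspace)
    have pure: "pure_tensor ?V ?V (g i) (h i) \<in> carrier ?T" if "i \<in> I" for i
      using I(2) that by (intro pure_tensor_closed) auto
    let ?t = "\<Oplus>\<^bsub>?T\<^esub>i\<in>I. pure_tensor ?V ?V (g i) (h i)"
    have "?e a b ?t = f (a * b)" for a b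
      using I pure
      by (simp add: linear_maps_finsum[OF tensor_vspace scalar_vspace
        tensor_functional_linear[OF V V ev ev]]
          finsum_scalar_space tensor_functional_pure[OF V V ev ev])
    moreover have "?t \<in> carrier ?T" using pure by (intro T.finsum_closed) auto
    ultimately show "\<exists>t. t \<in> carrier ?T \<and> (\<forall>a b. ?e a b t = f (a * b))" by blast
  next
    fix s t
    assume "s \<in> carrier ?T \<and> (\<forall>a b. ?e a b s = f (a * b))"
      "t \<in> carrier ?T \<and> (\<forall>a b. ?e a b t = f (a * b))"
    then show "s = t"
      by (intro separating_eqI[OF tensor_vspace separating_tensor[OF V V sep sep]]) auto
  qed
  show ?thesis
  proof (rule monoid_coordinates.intro)
    show "vspace (functional_coalgebra F)"
      by (rule vspace_cong[OF V]) (simp_all add: functional_coalgebra_def Let_def)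
    show "separating (functional_coalgebra F) (\<lambda>a f. f a)"
      using sep by (subst separating_cong[where V' = ?V])
        (simp_all add: functional_coalgebra_def Let_def)
    fix f assume "f \<in> carrier (functional_coalgebra F)"
    then have f: "f \<in> F" by (simp add: functional_coalgebra_def Let_def)
    have "comult (functional_coalgebra F) f = (THE t. t \<in> carrier ?T \<and>
      (\<forall>a b. ?e a b t = f (a * b)))"
      by (simp add: functional_coalgebra_def Let_def tensor_functional_def)
    with theI'[OF comult[OF f]]
    have \<Delta>: "comult (functional_coalgebra F) f \<in> carrier ?T"
      "?e a b (comult (functional_coalgebra F) f) = f (a * b)" for a b
      by auto
    show "?e a b (comult (functional_coalgebra F) f) = f (a * b)" for a b by (rule \<Delta>(2))
    show "comult (functional_coalgebra F) f \<in>
        carrier (tensor_space (functional_coalgebra F) (functional_coalgebra F))"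
      using \<Delta>(1) by (simp add: functional_coalgebra_def Let_def)
  qed (auto simp: functional_coalgebra_def Let_def mult.assoc)
qed

lemma divided_power_space_simps [simp]:
  "carrier divided_power_space = UNIV" "zero divided_power_space = 0"
  "add divided_power_space = (+)" "smult divided_power_space = pm_scale"
  by (simp_all add: divided_power_space_def)

lemma monoid_coordinates_divided_power:
  "monoid_coordinates (divided_power_coalgebra :: ('k::field, nat \<Rightarrow>\<^sub>0 'k) coalg)
     (\<lambda>n u. Poly_Mapping.lookup u n) (+) 0"
proof -
  let ?V = "divided_power_space :: ('k, nat \<Rightarrow>\<^sub>0 'k) module"
  let ?T = "tensor_space ?V ?V"
  let ?C = "divided_power_coalgebra :: ('k, nat \<Rightarrow>\<^sub>0 'k) coalg"
  have V: "vspace ?V"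
    by (rule vspaceI) (auto simp: algebra_simps pm.scale_left_distrib pm.scale_right_distrib)
  interpret T: Module.module type_ring ?T by (rule tensor_vspace)
  have sep: "separating ?V (\<lambda>n u. Poly_Mapping.lookup u n)"
    by (auto simp: separating_def lookup_add intro!: linear_mapsI poly_mapping_eqI)
  have ev: "(\<lambda>u. Poly_Mapping.lookup u n) \<in> linear_maps ?V scalar_space" for n
    by (rule separatingD[OF sep])
  let ?e = "\<lambda>i j. tensor_functional (\<lambda>u. Poly_Mapping.lookup u i) (\<lambda>u. Poly_Mapping.lookup u j)"
  note e_linear = tensor_functional_linear[OF V V ev ev]
  let ?pure = "\<lambda>n i. pure_tensor ?V ?V (Poly_Mapping.single i 1) (Poly_Mapping.single (n - i) 1)"
  let ?c = "\<lambda>n. \<Oplus>\<^bsub>?T\<^esub>i\<in>{..n}. ?pure n i"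
  have pure: "?pure n i \<in> carrier ?T" for n i by (rule pure_tensor_closed) simp_all
  have c: "?c n \<in> carrier ?T" for n using pure by (intro T.finsum_closed) auto
  have uc: "a \<odot>\<^bsub>?T\<^esub> ?c n \<in> carrier ?T" for a n using T.smult_closed[of a "?c n"] c by simp
  \<comment> \<open>only \<open>c\<^sub>i \<otimes> c\<^sub>j\<close> has a nonzero coordinate \<open>(i, j)\<close>,
    and it occurs in \<open>\<Delta> c\<^sub>n\<close> exactly for \<open>n = i + j\<close>\<close>
  have e_c: "?e i j (?c n) = (if n = i + j then 1 else 0)" for i j n
  proof -
    have "?e i j (?c n) = (\<Sum>l\<le>n. ?e i j (?pure n l))"
      by (simp add: linear_maps_finsum[OF tensor_vspace scalar_vspace e_linear] pure
        finsum_scalar_space)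
    also have "\<dots> = (\<Sum>l\<le>n. if l = i then (if n - i = j then 1 else 0) else 0)"
      by (intro sum.cong) (auto simp: tensor_functional_pure[OF V V ev ev] lookup_single when_def)
    also have "\<dots> = (if n = i + j then 1 else 0)" by (auto simp: sum.delta)
    finally show ?thesis .
  qed
  have comult: "comult ?C u = (\<Oplus>\<^bsub>?T\<^esub>n\<in>Poly_Mapping.keys u. Poly_Mapping.lookup u n \<odot>\<^bsub>?T\<^esub> ?c n)" for u
    by (simp add: divided_power_coalgebra_def Let_def)
  show ?thesis
  proof (rule monoid_coordinates.intro)
    show "vspace ?C"
      by (rule vspace_cong[OF V]) (simp_all add: divided_power_coalgebra_def Let_def)
    show "separating ?C (\<lambda>n u. Poly_Mapping.lookup u n)"
      using sep by (subst separating_cong[where V' = ?V])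
        (simp_all add: divided_power_coalgebra_def Let_def)
    fix u :: "nat \<Rightarrow>\<^sub>0 'k"
    have "comult ?C u \<in> carrier ?T" unfolding comult using uc by (intro T.finsum_closed) auto
    then show "comult ?C u \<in> carrier (tensor_space ?C ?C)"
      by (simp add: divided_power_coalgebra_def Let_def)
    show "?e i j (comult ?C u) = Poly_Mapping.lookup u (i + j)" for i j
    proof -
      have "?e i j (comult ?C u) = (\<Sum>n\<in>Poly_Mapping.keys u. Poly_Mapping.lookup u n *
        ?e i j (?c n))"
        unfolding comult
        by (simp add: linear_maps_finsum[OF tensor_vspace scalar_vspace e_linear] uc
          finsum_scalar_space
            linear_mapsD(3)[OF e_linear] c)
      also have "\<dots> = (\<Sum>n\<in>Poly_Mapping.keys u. if n = i + j then Poly_Mapping.lookup u n else 0)"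
        by (intro sum.cong) (simp_all add: e_c)
      also have "\<dots> = Poly_Mapping.lookup u (i + j)" by (auto simp: sum.delta in_keys_iff)
      finally show ?thesis .
    qed
    have "counit ?C u = (\<Sum>n\<in>Poly_Mapping.keys u. Poly_Mapping.lookup u n *
      (if n = 0 then 1 else 0))"
      by (simp add: divided_power_coalgebra_def Let_def)
    also have "\<dots> = (\<Sum>n\<in>Poly_Mapping.keys u. if n = 0 then Poly_Mapping.lookup u n else 0)"
      by (rule sum.cong) simp_all
    finally show "counit ?C u = Poly_Mapping.lookup u 0" by (auto simp: sum.delta in_keys_iff)
  qed (auto simp: add.assoc)
qed

section \<open>The dual of a finite-dimensional algebra\<close>

lemma dual_spaceD:
  assumes "f \<in> dual_space scale"
  shows "f (a + b) = f a + f b" "f (scale c a) = c * f a" "f 0 = 0" "f (sum g A) = (\<Sum>i\<in>A. f (g i))"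
    "f (a - b) = f a - f b"
proof -
  interpret Vector_Spaces.linear scale "(*)" f using assms by (simp add: dual_space_def)
  show "f (a + b) = f a + f b" "f (scale c a) = c * f a" "f 0 = 0" "f (sum g A) = (\<Sum>i\<in>A. f (g i))"
    "f (a - b) = f a - f b"
    by (simp_all add: add scale sum diff)
qed

context k_algebra
begin

lemma dual_spaceI:
  assumes "\<And>a b. f (a + b) = f a + f b" "\<And>c a. f (scale c a) = c * f a"
  shows "f \<in> dual_space scale"
proof -
  interpret K: Vector_Spaces.vector_space "(*) :: 'k \<Rightarrow> 'k \<Rightarrow> 'k"
    by unfold_locales (auto simp: algebra_simps)
  show ?thesis
    unfolding dual_space_def using assms
    by (auto intro!: Vector_Spaces.linear.intro module_hom.intro module_hom_axioms.intro
        vector_space_axioms K.vector_space_axioms module_axioms K.module_axioms)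
qed

lemma dual_space_closed:
  "(\<lambda>_. 0) \<in> dual_space scale"
  "f \<in> dual_space scale \<Longrightarrow> g \<in> dual_space scale \<Longrightarrow> (\<lambda>a. f a + g a) \<in> dual_space scale"
  "f \<in> dual_space scale \<Longrightarrow> (\<lambda>a. c * f a) \<in> dual_space scale"
  "f \<in> dual_space scale \<Longrightarrow> (\<lambda>a. f (b * a)) \<in> dual_space scale"
  by (auto intro!: dual_spaceI simp: dual_spaceD algebra_simps scale_mult_right)

lemma k_algebra_fps: "k_algebra (fps_scale scale)"
proof unfold_locales
  show "fps_scale scale c f * g = fps_scale scale c (f * g)" for c f g
    by (rule fps_ext) (simp add: fps_scale_def fps_mult_nth scale_mult_left scale_sum_right)
  show "f * fps_scale scale c g = fps_scale scale c (f * g)" for c f g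
    by (rule fps_ext) (simp add: fps_scale_def fps_mult_nth scale_mult_right scale_sum_right)
qed (auto simp: fps_scale_def fps_eq_iff scale_left_distrib scale_right_distrib)

end

locale finite_dimensional_k_algebra = k_algebra scale + finite_dimensional_vector_space scale Basis
  for scale :: "'k::field \<Rightarrow> 'd::ring_1 \<Rightarrow> 'd" and Basis
begin

abbreviation coordinate :: "'d \<Rightarrow> 'd \<Rightarrow> 'k" where
  "coordinate b d \<equiv> representation Basis d b"

lemma coordinate_dual: "coordinate b \<in> dual_space scale"
  by (rule dual_spaceI) (simp_all add: representation_add representation_scale independent_Basis
    span_Basis)

lemma basis_expansion: "d = (\<Sum>b\<in>Basis. scale (coordinate b d) b)"
  by (simp add: sum_representation_eq independent_Basis span_Basis finite_Basis)

text \<open>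
  With a basis \<open>b\<close> of the algebra and its dual basis \<open>b\<^sup>*\<close>, expanding the first factor of a product
  gives \<open>f (a d) = \<Sum> b\<^sup>*(a) f (b d)\<close>.
\<close>

lemma monoid_coordinates_dual: "monoid_coordinates (dual_coalgebra scale) (\<lambda>d f. f d) (*) 1"
  unfolding dual_coalgebra_def
proof (rule monoid_coordinates_functional)
  fix f :: "'d \<Rightarrow> 'k" assume f: "f \<in> dual_space scale"
  have "f (a * d) = (\<Sum>b\<in>Basis. coordinate b a * f (b * d))" for a d
  proof -
    have "f (a * d) = f ((\<Sum>b\<in>Basis. scale (coordinate b a) b) * d)"
      by (simp flip: basis_expansion)
    then show ?thesis by (simp add: sum_distrib_right dual_spaceD[OF f] scale_mult_left)
  qed
  then show "\<exists>(I :: 'd set) g h. finite I \<and> (\<forall>i\<in>I. g i \<in> dual_space scale \<and>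
    h i \<in> dual_space scale) \<and>
      (\<forall>a b. f (a * b) = (\<Sum>i\<in>I. g i a * h i b))"
    using coordinate_dual dual_space_closed(4)[OF f] finite_Basis
    by (intro exI[of _ Basis] exI[of _ coordinate] exI[of _ "\<lambda>b d. f (b * d)"]) blast
qed (fact dual_space_closed)+

end

section \<open>The finite dual of the power series algebra\<close>

unbundle fps_syntax

definition monomial :: "'d::ring_1 \<Rightarrow> nat \<Rightarrow> 'd fps" where
  "monomial d i = fps_const d * fps_X ^ i"

lemma monomial_nth [simp]: "monomial d i $ n = (if n = i then d else 0)"
  by (simp add: monomial_def fps_X_power_mult_right_nth)

lemma monomial_mult: "monomial d i * monomial d' j = monomial (d * d') (i + j)"
proof -
  have "monomial d i * monomial d' j = fps_const d * (fps_X ^ i * fps_const d') * fps_X ^ j"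
    by (simp add: monomial_def mult.assoc)
  also have "\<dots> = fps_const d * (fps_const d' * fps_X ^ i) * fps_X ^ j"
    by (simp only: fps_mult_fps_X_power_commute[of i "fps_const d'"])
  also have "\<dots> = (fps_const d * fps_const d') * (fps_X ^ i * fps_X ^ j)"
    by (simp only: mult.assoc)
  finally show ?thesis by (simp add: monomial_def power_add)
qed

lemma fps_truncate: "i < N \<Longrightarrow> (a - (\<Sum>j<N. monomial (a $ j) j)) $ i = 0"
  by (simp add: fps_sum_nth)

context finite_dimensional_k_algebra
begin

abbreviation "series_scale \<equiv> fps_scale scale"

sublocale fps: k_algebra series_scale by (rule k_algebra_fps)

lemma series_scale_nth [simp]: "series_scale c f $ n = scale c (f $ n)"
  by (simp add: fps_scale_def)

lemma monomial_expansion: "monomial d i = (\<Sum>b\<in>Basis. series_scale (coordinate b d) (monomial b i))"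
  by (rule fps_ext) (auto simp: fps_sum_nth simp flip: basis_expansion)

text \<open>
  The functionals that are continuous for the \<open>x\<close>-adic topology on power series and the discrete
  topology on the field.
\<close>

definition continuous_dual :: "('d fps \<Rightarrow> 'k) set" where
  "continuous_dual = {f \<in> dual_space series_scale. \<exists>N. \<forall>a. (\<forall>i<N. a $ i = 0) \<longrightarrow> f a = 0}"

lemma continuous_dualD: "f \<in> continuous_dual \<Longrightarrow> f \<in> dual_space series_scale"
  by (simp add: continuous_dual_def)

lemma continuous_dual_eval:
  assumes "f \<in> dual_space series_scale" "\<And>a. \<forall>i<N. a $ i = 0 \<Longrightarrow> f a = 0"
  shows "f a = (\<Sum>i<N. f (monomial (a $ i) i))"
proof -
  have "f (a - (\<Sum>i<N. monomial (a $ i) i)) = 0" using assms(2) fps_truncate by blast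
  then show ?thesis by (simp add: dual_spaceD[OF assms(1)])
qed

text \<open>
  The series of order at least \<open>N\<close> form an ideal, and modulo this ideal the finitely many
  monomials \<open>b x\<^sup>i\<close> with \<open>b\<close> in the basis and \<open>i < N\<close> span.
\<close>

lemma continuous_dual_finite_dual:
  assumes f: "f \<in> continuous_dual"
  shows "\<exists>I. ideal I type_ring \<and> finite_codimension series_scale I \<and> (\<forall>a\<in>I. f a = 0)"
proof -
  obtain N where N: "\<And>a. \<forall>i<N. a $ i = 0 \<Longrightarrow> f a = 0" using f by (auto simp: continuous_dual_def)
  let ?I = "{a :: 'd fps. \<forall>i<N. a $ i = 0}"
  let ?B = "(\<lambda>(b, i). monomial b i) ` (Basis \<times> {..<N})"
  have "ideal ?I type_ring"
  proof (rule idealI[OF ring_type_ring])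
    have "group (add_monoid (type_ring :: 'd fps ring))"
      by (rule abelian_group.a_group[OF abelian_group_type_ring])
    then show "subgroup ?I (add_monoid (type_ring :: 'd fps ring))"
    proof (rule group.subgroupI)
      fix a :: "'d fps" assume a: "a \<in> ?I"
      have "inv\<^bsub>add_monoid type_ring\<^esub> a = - a"
        using \<open>group _\<close> by (intro group.inv_equality) auto
      with a show "inv\<^bsub>add_monoid type_ring\<^esub> a \<in> ?I" by simp
    qed (auto intro: exI[of _ 0])
  qed (auto simp: fps_mult_nth)
  moreover have "fps.span (?I \<union> ?B) = UNIV"
  proof (intro equalityI subsetI UNIV_I)
    fix a :: "'d fps"
    have mono: "monomial d i \<in> fps.span (?I \<union> ?B)" if "i < N" for d i
      unfolding monomial_expansion[of d]
      by (intro fps.span_sum fps.span_scale fps.span_base UnI2) (use that in auto)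
    have "a - (\<Sum>i<N. monomial (a $ i) i) \<in> fps.span (?I \<union> ?B)"
      using fps_truncate by (intro fps.span_base UnI1) blast
    moreover have "(\<Sum>i<N. monomial (a $ i) i) \<in> fps.span (?I \<union> ?B)"
      by (intro fps.span_sum mono) simp
    ultimately show "a \<in> fps.span (?I \<union> ?B)"
      using fps.span_add by fastforce
  qed
  ultimately show ?thesis
    using N finite_Basis unfolding finite_codimension_def
    by (intro exI[of _ ?I] conjI exI[of _ ?B]) auto
qed


lemma independent_monomials: "fps.independent (range (monomial (1 :: 'd)))"
  unfolding fps.independent_explicit_module
proof (intro allI impI)
  fix t u v assume t: "finite t" "t \<subseteq> range (monomial (1 :: 'd))"
    "(\<Sum>v\<in>t. series_scale (u v) v) = 0" "v \<in> t"
  then obtain i where i: "v = monomial 1 i" by blast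
  have "(\<Sum>w\<in>t. series_scale (u w) w) $ i = (\<Sum>w\<in>t. if w = v then scale (u v) 1 else 0)"
    unfolding fps_sum_nth using t(2) by (intro sum.cong)
      (auto simp: i dest!: subsetD split: if_splits)
  then have "scale (u v) (1 :: 'd) = 0" using t by simp
  then show "u v = 0" by simp
qed

text \<open>
  The powers of \<open>x\<close> are linearly independent. This excludes the zero ideal as a witness that a
  functional belongs to the finite dual.
\<close>

lemma infinite_codimension_zero: "\<not> finite_codimension series_scale {0}"
proof
  assume "finite_codimension series_scale {0}"
  then obtain B where B: "finite B" "fps.span ({0} \<union> B) = UNIV"
    by (auto simp: finite_codimension_def)
  then have "finite (range (monomial (1 :: 'd)))"
    using fps.independent_span_bound[OF _ independent_monomials, of "{0} \<union> B"] by auto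
  moreover have "inj (monomial (1 :: 'd))"
    by (rule injI) (metis monomial_nth zero_neq_one)
  ultimately show False using finite_imageD[of "monomial (1 :: 'd)" UNIV] by simp
qed

lemma continuous_dual_closed:
  "(\<lambda>_. 0) \<in> continuous_dual"
  "f \<in> continuous_dual \<Longrightarrow> g \<in> continuous_dual \<Longrightarrow> (\<lambda>a. f a + g a) \<in> continuous_dual"
  "f \<in> continuous_dual \<Longrightarrow> (\<lambda>a. c * f a) \<in> continuous_dual"
proof -
  show "(\<lambda>_. 0) \<in> continuous_dual" "f \<in> continuous_dual \<Longrightarrow> (\<lambda>a. c * f a) \<in> continuous_dual"
    by (auto simp: continuous_dual_def fps.dual_space_closed)
  assume "f \<in> continuous_dual" "g \<in> continuous_dual"
  then obtain M N where f: "f \<in> dual_space series_scale" "\<And>a. \<forall>i<M. a $ i = 0 \<Longrightarrow> f a = 0"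
    and g: "g \<in> dual_space series_scale" "\<And>a. \<forall>i<N. a $ i = 0 \<Longrightarrow> g a = 0"
    by (auto simp: continuous_dual_def)
  then have "\<forall>a. (\<forall>i<max M N. a $ i = 0) \<longrightarrow> f a + g a = 0" by simp
  with f(1) g(1) show "(\<lambda>a. f a + g a) \<in> continuous_dual"
    by (auto simp: continuous_dual_def fps.dual_space_closed)
qed

text \<open>
  If \<open>f\<close> vanishes on the series of order at least \<open>N\<close>, then in \<open>f (a * a')\<close> the series \<open>a\<close> can be
  truncated at \<open>N\<close> and expanded into monomials \<open>b x\<^sup>i\<close>. The two resulting factors,
  \<open>a \<mapsto> b\<^sup>*(a\<^sub>i)\<close> and \<open>a' \<mapsto> f (b x\<^sup>i a')\<close>, are again continuous.
\<close>

lemma monoid_coordinates_continuous_dual: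
  "monoid_coordinates (functional_coalgebra continuous_dual) (\<lambda>a f. f a) (*) 1"
proof (rule monoid_coordinates_functional)
  fix f assume "f \<in> continuous_dual"
  then obtain N where f: "f \<in> dual_space series_scale" and N: "\<And>a. \<forall>i<N. a $ i = 0 \<Longrightarrow> f a = 0"
    by (auto simp: continuous_dual_def)
  let ?g = "\<lambda>(i, b) a. coordinate b (a $ i)"
  let ?h = "\<lambda>(i, b) a. f (monomial b i * a)"
  have "?g p \<in> continuous_dual" for p
  proof (cases p)
    case (Pair i b)
    have "?g (i, b) \<in> dual_space series_scale"
      by (auto intro!: fps.dual_spaceI simp: dual_spaceD[OF coordinate_dual])
    then show ?thesis
      by (auto simp: Pair continuous_dual_def dual_spaceD[OF coordinate_dual]
        intro!: exI[of _ "Suc i"])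
  qed
  moreover have "?h p \<in> continuous_dual" for p
  proof (cases p)
    case (Pair i b)
    have "f (monomial b i * a) = 0" if "\<forall>j<N. a $ j = 0" for a
      using that by (intro N) (auto simp: fps_mult_nth intro!: sum.neutral)
    then show ?thesis
      using fps.dual_space_closed(4)[OF f] by (auto simp: Pair continuous_dual_def)
  qed
  moreover have "f (a * a') = (\<Sum>p\<in>{..<N} \<times> Basis. ?g p a * ?h p a')" for a a'
  proof -
    have "f ((a - (\<Sum>i<N. monomial (a $ i) i)) * a') = 0"
      by (rule N) (auto simp: fps_mult_nth fps_truncate simp del: fps_sub_nth intro!: sum.neutral)
    then have "f (a * a') = f ((\<Sum>i<N. monomial (a $ i) i) * a')"
      by (simp add: left_diff_distrib dual_spaceD[OF f])
    also have "\<dots> = (\<Sum>i<N. f (monomial (a $ i) i * a'))"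
      by (simp add: sum_distrib_right dual_spaceD[OF f])
    also have "\<dots> = (\<Sum>i<N. \<Sum>b\<in>Basis. coordinate b (a $ i) * f (monomial b i * a'))"
      by (subst monomial_expansion) (simp add: sum_distrib_right
        dual_spaceD[OF f] fps.scale_mult_left)
    finally show ?thesis by (simp add: sum.cartesian_product split_def)
  qed
  moreover have "finite ({..<N} \<times> Basis)" using finite_Basis by simp
  ultimately show "\<exists>(I :: (nat \<times> 'd) set) g h. finite I \<and>
      (\<forall>i\<in>I. g i \<in> continuous_dual \<and> h i \<in> continuous_dual) \<and>
      (\<forall>a b. f (a * b) = (\<Sum>i\<in>I. g i a * h i b))"
    by (intro exI conjI ballI allI)
qed (fact continuous_dual_closed)+

end

text \<open>
  Write \<open>a = g x\<^sup>n\<close> with \<open>n\<close> the order of \<open>a\<close>. The constant term of \<open>g\<close> is invertible in the division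
  ring, so \<open>g\<close> is a unit; as \<open>x\<close> is central, the ideal contains \<open>x\<^sup>n\<close> and all its multiples.
\<close>

lemma ideal_contains_order:
  fixes I :: "'d::division_ring fps set"
  assumes I: "ideal I type_ring" and a: "a \<in> I" "a \<noteq> 0" and b: "\<forall>i<subdegree a. b $ i = 0"
  shows "b \<in> I"
proof -
  interpret ideal I type_ring by (rule I)
  let ?n = "subdegree a"
  let ?g = "fps_shift ?n a"
  have "?g $ 0 * inverse (?g $ 0) = 1" using a(2) by simp
  then obtain h where h: "?g * h = 1" using fps_right_inverse by blast
  have "a * h = ?g * (fps_X ^ ?n * h)"
    by (subst subdegree_decompose[of a]) (simp add: mult.assoc)
  also have "\<dots> = fps_X ^ ?n"
    by (simp only: fps_mult_fps_X_power_commute[of ?n h] mult.assoc[symmetric] h mult_1_left)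
  finally have "fps_X ^ ?n \<in> I" using I_r_closed[of a h] a(1) by simp
  moreover have "b = fps_shift ?n b * fps_X ^ ?n"
    using b by (intro fps_ext) (auto simp: fps_X_power_mult_right_nth)
  ultimately show ?thesis using I_l_closed[of "fps_X ^ ?n" "fps_shift ?n b"] by simp
qed

locale finite_dimensional_division_algebra = finite_dimensional_k_algebra scale Basis
  for scale :: "'k::field \<Rightarrow> 'd::division_ring \<Rightarrow> 'd" and Basis
begin

lemma finite_dual_eq: "finite_dual_coalgebra series_scale = functional_coalgebra continuous_dual"
proof -
  have "f \<in> continuous_dual"
    if f: "f \<in> dual_space series_scale" and I: "ideal I type_ring"
      "finite_codimension series_scale I" "\<forall>a\<in>I. f a = 0" for f I
  proof -
    have "0 \<in> I" using additive_subgroup.zero_closed[OF ideal.axioms(1)[OF I(1)]] by simp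
    then have "I \<noteq> {0} \<Longrightarrow> \<exists>a\<in>I. a \<noteq> 0" by blast
    then obtain a where a: "a \<in> I" "a \<noteq> 0"
      using I(2) infinite_codimension_zero by metis
    then show ?thesis
      using f I(3) ideal_contains_order[OF I(1) a] by (auto simp: continuous_dual_def)
  qed
  then have "{f \<in> dual_space series_scale. \<exists>I. ideal I type_ring \<and>
    finite_codimension series_scale I \<and> (\<forall>a\<in>I. f a = 0)} =
      continuous_dual"
    using continuous_dual_finite_dual by (auto intro: continuous_dualD)
  then show ?thesis by (simp add: finite_dual_coalgebra_def)
qed

text \<open>
  Under the isomorphism \<open>\<phi>\<close>, the coordinate \<open>(d, i)\<close> of \<open>\<phi> f\<close> is \<open>f (d x\<^sup>i)\<close>. Injectivity
  holds because a continuous functional is determined by these values, and surjectivity needs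
  only be checked on pure tensors.
\<close>

lemma finite_dual_isomorphic:
  "coalgebra_isomorphic (finite_dual_coalgebra series_scale)
     (tensor_coalgebra (dual_coalgebra scale) divided_power_coalgebra)"
proof -
  let ?A = "finite_dual_coalgebra series_scale"
  let ?V = "dual_coalgebra scale"
  let ?DC = "divided_power_coalgebra :: ('k, nat \<Rightarrow>\<^sub>0 'k) coalg"
  let ?T = "tensor_coalgebra ?V ?DC"
  let ?e = "\<lambda>(d, i). tensor_functional (\<lambda>g. g d) (\<lambda>u. Poly_Mapping.lookup u i)"
  note coordinates_A = monoid_coordinates_continuous_dual[folded finite_dual_eq]
  note coordinates_T = monoid_coordinates_tensor[OF monoid_coordinates_dual
    monoid_coordinates_divided_power]
  interpret A: monoid_coordinates ?A "\<lambda>a f. f a" "(*)" 1 by (rule coordinates_A)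
  interpret V: monoid_coordinates ?V "\<lambda>d g. g d" "(*)" 1 by (rule monoid_coordinates_dual)
  interpret DC: monoid_coordinates ?DC "\<lambda>i u. Poly_Mapping.lookup u i" "(+)" 0
    by (rule monoid_coordinates_divided_power)
  interpret T: monoid_coordinates ?T ?e "\<lambda>(d, i) (d', j). (d * d', i + j)" "(1, 0)"
    by (rule coordinates_T)
  interpret M: Module.module type_ring ?T by (rule T.vspace)
  have A: "carrier ?A = continuous_dual"
    by (simp add: finite_dual_eq functional_coalgebra_def Let_def)
  have V: "carrier ?V = dual_space scale"
    by (simp add: dual_coalgebra_def functional_coalgebra_def Let_def)
  have DC: "carrier ?DC = UNIV" by (simp add: divided_power_coalgebra_def Let_def)
  have T: "carrier ?T = carrier (tensor_space ?V ?DC)" "add ?T = add (tensor_space ?V ?DC)"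
    by (simp_all add: tensor_coalgebra_def)
  have e_pure: "?e (d, i) (pure_tensor ?V ?DC g u) = g d * Poly_Mapping.lookup u i"
    if "g \<in> dual_space scale" for d i g u
    using tensor_functional_pure[OF V.vspace DC.vspace V.e_linear DC.e_linear] that
      by (simp add: V DC)
  have pure: "pure_tensor ?V ?DC g u \<in> carrier ?T" if "g \<in> dual_space scale" for g u
    unfolding T(1) using that by (intro pure_tensor_closed) (simp_all add: V DC)
  have "\<exists>t\<in>carrier ?T. \<forall>p. ?e p t = f (case p of (d, i) \<Rightarrow> monomial d i)" if "f \<in> continuous_dual"
    for f
  proof -
    from that obtain N where f: "f \<in> dual_space series_scale" and N: "\<And>a. \<forall>i<N. a $ i = 0 \<Longrightarrow> f a = 0"
      by (auto simp: continuous_dual_def)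
    \<comment> \<open>the image of \<open>f\<close> is \<open>\<Sum>\<^sub>n (d \<mapsto> f (d x\<^sup>n)) \<otimes> c\<^sub>n\<close>\<close>
    let ?g = "\<lambda>n d. f (monomial d n)"
    let ?p = "\<lambda>n. pure_tensor ?V ?DC (?g n) (Poly_Mapping.single n 1)"
    have g: "?g n \<in> dual_space scale" for n
    proof (rule dual_spaceI)
      have "monomial (a + b) n = monomial a n + monomial b n"
        "monomial (scale c a) n = series_scale c (monomial a n)" for a b c
        by (auto intro!: fps_ext)
      then show "?g n (a + b) = ?g n a + ?g n b" "?g n (scale c a) = c * ?g n a" for a b c
        by (simp_all add: dual_spaceD[OF f])
    qed
    have "?e (d, i) (\<Oplus>\<^bsub>?T\<^esub>n\<in>{..<N}. ?p n) = f (monomial d i)" for d i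
    proof -
      have "?e (d, i) (\<Oplus>\<^bsub>?T\<^esub>n\<in>{..<N}. ?p n) = (\<Sum>n<N. ?e (d, i) (?p n))"
        by (subst linear_maps_finsum[OF T.vspace scalar_vspace T.e_linear])
          (simp_all add: pure g finsum_scalar_space)
      also have "\<dots> = (\<Sum>n<N. if n = i then f (monomial d i) else 0)"
        by (intro sum.cong refl, subst e_pure[OF g]) (simp add: lookup_single when_def)
      also have "\<dots> = f (monomial d i)" using N[of "monomial d i"] by (auto simp: sum.delta)
      finally show ?thesis .
    qed
    moreover have "(\<Oplus>\<^bsub>?T\<^esub>n\<in>{..<N}. ?p n) \<in> carrier ?T" using pure g by (intro M.finsum_closed) auto
    ultimately show ?thesis by (intro bexI) auto
  qed
  then obtain \<phi> where \<phi>: "\<phi> f \<in> carrier ?T" "?e p (\<phi> f) = f (case p of (d, i) \<Rightarrow> monomial d i)"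
    if "f \<in> continuous_dual" for f p by metis
  have hom: "\<phi> \<in> coalgebra_hom ?A ?T"
    by (rule coalgebra_hom_coordinates[OF coordinates_A coordinates_T, where h =
      "\<lambda>(d, i). monomial d i"])
      (use \<phi> in \<open>auto simp: A monomial_mult split: prod.split\<close>, auto simp: monomial_def)
  have "inj_on \<phi> continuous_dual"
  proof (rule inj_onI, rule ext)
    fix f g a assume fg: "f \<in> continuous_dual" "g \<in> continuous_dual" "\<phi> f = \<phi> g"
    have eq: "f (monomial d i) = g (monomial d i)" for d i
      using \<phi>(2)[OF fg(1), of "(d, i)"] \<phi>(2)[OF fg(2), of "(d, i)"] fg(3) by simp
    let ?d = "\<lambda>a. f a + (-1) * g a"
    have "?d \<in> continuous_dual" by (intro continuous_dual_closed fg)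
    then obtain N where "?d \<in> dual_space series_scale" "\<And>a. \<forall>i<N. a $ i = 0 \<Longrightarrow> ?d a = 0"
      unfolding continuous_dual_def by blast
    from continuous_dual_eval[OF this] show "f a = g a" by (simp add: eq)
  qed
  moreover have "\<exists>f\<in>continuous_dual. \<phi> f = t" if "t \<in> carrier ?T" for t
  proof -
    have "\<exists>f\<in>continuous_dual. \<forall>d i. f (monomial d i) = ?e (d, i) t"
      using that[unfolded T(1)] V.vspace DC.vspace
    proof (induction rule: tensor_induct)
      case (pure g u)
      let ?f = "\<lambda>a. \<Sum>n\<in>Poly_Mapping.keys u. Poly_Mapping.lookup u n * g (a $ n)"
      have g: "g \<in> dual_space scale" using pure by (simp add: V)
      have "?f \<in> dual_space series_scale"
        by (rule fps.dual_spaceI) (simp_all add: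
          dual_spaceD[OF g] sum.distrib sum_distrib_left algebra_simps)
      moreover obtain N where "\<forall>n\<in>Poly_Mapping.keys u. n < N"
        using finite_nat_set_iff_bounded[THEN iffD1, OF finite_keys] by blast
      then have "\<forall>a. (\<forall>i<N. a $ i = 0) \<longrightarrow> ?f a = 0"
        by (auto simp: dual_spaceD[OF g] intro!: sum.neutral)
      ultimately have "?f \<in> continuous_dual" by (auto simp: continuous_dual_def)
      moreover have "?f (monomial d i) = ?e (d, i) (pure_tensor ?V ?DC g u)" for d i
      proof -
        have "?f (monomial d i) = (\<Sum>n\<in>Poly_Mapping.keys u.
          if n = i then Poly_Mapping.lookup u n * g d else 0)"
          by (intro sum.cong) (auto simp: dual_spaceD[OF g])
        then show ?thesis unfolding e_pure[OF g] by (auto simp: sum.delta in_keys_iff)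
      qed
      ultimately show ?case by (intro bexI[of _ ?f] allI)
    next
      case (add s t)
      then obtain f g where "f \<in> continuous_dual" "\<And>d i. f (monomial d i) = ?e (d, i) s"
        "g \<in> continuous_dual" "\<And>d i. g (monomial d i) = ?e (d, i) t" by metis
      then show ?case
        using linear_mapsD(2)[OF T.e_linear] add(1,2)
        by (intro bexI[of _ "\<lambda>a. f a + g a"] continuous_dual_closed) (auto simp flip: T)
    qed
    then obtain f where f: "f \<in> continuous_dual" "\<And>d i. f (monomial d i) = ?e (d, i) t" by blast
    have "\<phi> f = t"
      by (rule separating_eqI[OF T.vspace T.separating \<phi>(1)[OF f(1)] that])
        (use \<phi>(2)[OF f(1)] f(2) in auto)
    with f(1) show ?thesis by blast
  qed
  ultimately have "bij_betw \<phi> (carrier ?A) (carrier ?T)"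
    using \<phi>(1) by (auto simp: A bij_betw_def)
  with hom show ?thesis
    using A.coalgebra T.coalgebra by (auto simp: coalgebra_isomorphic_def)
qed

end

theorem mainTheorem8:
  fixes scale :: "'k::field \<Rightarrow> 'd::division_ring \<Rightarrow> 'd"
  assumes "k_algebra scale"
    and "\<exists>B. finite_dimensional_vector_space scale B"
  shows "coalgebra_isomorphic
           (finite_dual_coalgebra (fps_scale scale))
           (tensor_coalgebra (dual_coalgebra scale) divided_power_coalgebra)"
proof -
  from assms(2) obtain B where "finite_dimensional_vector_space scale B" by blast
  with assms(1) interpret finite_dimensional_division_algebra scale B
    by (intro finite_dimensional_division_algebra.intro finite_dimensional_k_algebra.intro)
  show ?thesis by (rule finite_dual_isomorphic)
qed

end
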